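(* Let $B$ be the cdga constructed in the context and let $n\ge12$. Then the quadruple Massey product $\langle[X],[Y],[Y],[\widehat{Ye}+\widehat{\alpha\gamma}]\rangle$ is non-trivial in the Poincaré dualization $P_n(B)$, i.e. it is defined and does not contain $0$.
   Context: Everything is over $\mathbb{Q}$; $\Lambda(\cdot)$ denotes the free graded-commutative algebra. Construction of $A$. $A=(\Lambda V,d)$ with $V^{\le5}$ having basis: degree 2: $X,Y$ with $dX=dY=0$; degree 3: $a,b,c$ with $da=X^2$, $db=XY$, $dc=Y^2$; degree 4: $e,f$ with $de=Ya-Xb$, $df=Yb-Xc$; degree 5: $h,i$ with $dh=Xe+ab$, $di=Yf+bc$. The space $V^{\ge6}$ is constructed inductively so as to kill all cohomology in degrees $\ge7$: choose cocycles representing a basis of degree $7$ cohomology, introduce for each of them a generator in $V^6$ mapped by $d$ to that cocycle, and repeat for degrees $8,9,\dots$ with generators in $V^7,V^8,\dots$. Put $m=Ye+ac+Xf$. Construction of $B$. $B=(A\otimes\Lambda W,d)$, containing $A$ as a sub-cdga, with $W^{\le5}$ having basis: degree 3: $\alpha,\gamma$ with $d\alpha=d\gamma=0$; degree 4: $s_{X\alpha},s_{Y\alpha},s_{X\gamma},s_{Y\gamma}$ with $ds_{X\alpha}=X\alpha$, $ds_{Y\alpha}=Y\alpha$, $ds_{X\gamma}=X\gamma$, $ds_{Y\gamma}=Y\gamma$; degree 5: $t_1,\dots,t_9$ with $dt_i=v_i$, where $v_1=m-\alpha\gamma$, $v_2=Ys_{X\alpha}-Xs_{Y\alpha}$, $v_3=Ys_{X\gamma}-Xs_{Y\gamma}$,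 $v_4=a\alpha-Xs_{X\alpha}$, $v_5=b\alpha-Xs_{Y\alpha}$, $v_6=c\alpha-Ys_{Y\alpha}$, $v_7=a\gamma-Xs_{X\gamma}$, $v_8=b\gamma-Xs_{Y\gamma}$, $v_9=c\gamma-Ys_{Y\gamma}$. The space $W^{\ge6}$ is constructed in the same inductive way, killing all cohomology in degrees $\ge7$, so that $H^{\ge7}(B)=0$. Dualization. $(D_nB)^k:=(B^{n-k})^\vee$ with $d(\varphi)(x):=(-1)^{|\varphi|-1}\varphi(dx)$. $P_nB:=B\oplus D_nB$ as a complex, with multiplication extending that of $B$ by $(x\wedge\varphi)(y):=(-1)^{|x||\varphi|}\varphi(x\wedge y)$, $(\varphi\wedge x)(y):=\varphi(x\wedge y)$, and $\varphi\wedge\psi=0$ for $\varphi,\psi\in D_nB$. Consider the basis of $B$ given by the monomials in the chosen generators (with $Ye$ and $\alpha\gamma$, in this order of factors, among the basis monomials); for such a monomial $p$, $\widehat p\in D_nB$ denotes the functional which is $1$ on $p$ and $0$ on all other basis monomials. Massey products: for homogeneous classes $x_1,\dots,x_r$ (here $r=4$), a defining system consists of homogeneous elements $a_{i,j}$, $0\le i<j\le r$, $(i,j)\neq(0,r)$, where $a_{i-1,i}$ is a closed representative of $x_i$ and $da_{i,j}=\sum_{i<l<j}\bar a_{i,l}a_{l,j}$ for $j-i\ge2$, with $\bar a=(-1)^{|a|+1}a$. It yields the class $[\sum_{0<l<r}\bar a_{0,l}a_{l,r}]$. The Massey product is the set of all classes so obtained; it is defined if a defining system exists. *)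

theory Defs
  imports
    Complex_Main
    "HOL-Library.Multiset"
    "HOL-Library.Poly_Mapping"
    "HOL-Library.Function_Algebras"
    "HOL-Library.Product_Plus"
    "HOL-Library.Nat_Bijection"
begin

section \<open>Differential graded algebras, cohomology classes, Massey products\<close>

text \<open>
  A differential graded algebra over the rationals is presented by its homogeneous pieces inside
  an ambient abelian group, graded by the integers because the dualization below has
  pieces in negative degrees. The differential has degree \<open>1\<close>.
\<close>

record 'a dga =
  gr :: "int \<Rightarrow> 'a set"
  scal :: "rat \<Rightarrow> 'a \<Rightarrow> 'a"
  mul :: "'a \<Rightarrow> 'a \<Rightarrow> 'a"
  diff :: "'a \<Rightarrow> 'a"

definition cocycles :: "('a::ab_group_add) dga \<Rightarrow> int \<Rightarrow> 'a set" where
  "cocycles C k = {x \<in> gr C k. diff C x = 0}"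

definition coh_class :: "('a::ab_group_add) dga \<Rightarrow> int \<Rightarrow> 'a \<Rightarrow> 'a set" where
  "coh_class C k x = {x + diff C y | y. y \<in> gr C (k - 1)}"

text \<open>The family \<open>z\<close>, indexed by \<open>I\<close>, consists of cocycles whose classes form a
  basis of the cohomology in degree \<open>k\<close>.\<close>

definition represents_basis ::
    "('a::ab_group_add) dga \<Rightarrow> int \<Rightarrow> 'i set \<Rightarrow> ('i \<Rightarrow> 'a) \<Rightarrow> bool" where
  "represents_basis C k I z \<longleftrightarrow>
     (\<forall>i\<in>I. z i \<in> cocycles C k) \<and>
     (\<forall>x\<in>cocycles C k. \<exists>F c. finite F \<and> F \<subseteq> I \<and>
        coh_class C k x = coh_class C k (\<Sum>i\<in>F. scal C (c i) (z i))) \<and>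
     (\<forall>F c. finite F \<and> F \<subseteq> I \<and>
        coh_class C k (\<Sum>i\<in>F. scal C (c i) (z i)) = coh_class C k 0 \<longrightarrow> (\<forall>i\<in>F. c i = 0))"

text \<open>\<open>bar k x\<close> is \<open>(-1)\<^sup>k\<^sup>+\<^sup>1 x\<close>, to be used for \<open>x\<close> of degree \<open>k\<close>.\<close>

definition bar :: "int \<Rightarrow> 'a::ab_group_add \<Rightarrow> 'a" where
  "bar k x = (if odd k then x else - x)"

text \<open>
  Massey products of a list of pairs \<open>(degree, class)\<close>. The element \<open>a\<^sub>i\<^sub>j\<close> of a
  defining system lives in the degree forced by the equations, namely the sum of the degrees of
  the classes number \<open>i+1, \<dots>, j\<close> minus \<open>j - i - 1\<close>. (The list indices start at \<open>0\<close>.)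
\<close>

definition massey_deg :: "(int \<times> 'a set) list \<Rightarrow> nat \<Rightarrow> nat \<Rightarrow> int" where
  "massey_deg xs i j = (\<Sum>l\<in>{i..<j}. fst (xs ! l)) - (int j - int i - 1)"

definition defining_system ::
    "('a::ab_group_add) dga \<Rightarrow> (int \<times> 'a set) list \<Rightarrow> (nat \<Rightarrow> nat \<Rightarrow> 'a) \<Rightarrow> bool" where
  "defining_system C xs a \<longleftrightarrow>
     (\<forall>i j. i < j \<and> j \<le> length xs \<and> (i, j) \<noteq> (0, length xs) \<longrightarrow>
        a i j \<in> gr C (massey_deg xs i j)) \<and>
     (\<forall>i < length xs. diff C (a i (Suc i)) = 0 \<and> a i (Suc i) \<in> snd (xs ! i)) \<and>
     (\<forall>i j. i + 2 \<le> j \<and> j \<le> length xs \<and> (i, j) \<noteq> (0, length xs) \<longrightarrow>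
        diff C (a i j) = (\<Sum>l\<in>{i<..<j}. mul C (bar (massey_deg xs i l) (a i l)) (a l j)))"

definition massey_value ::
    "('a::ab_group_add) dga \<Rightarrow> (int \<times> 'a set) list \<Rightarrow> (nat \<Rightarrow> nat \<Rightarrow> 'a) \<Rightarrow> 'a" where
  "massey_value C xs a =
     (\<Sum>l\<in>{0<..<length xs}. mul C (bar (massey_deg xs 0 l) (a 0 l)) (a l (length xs)))"

definition massey_product :: "('a::ab_group_add) dga \<Rightarrow> (int \<times> 'a set) list \<Rightarrow> 'a set set" where
  "massey_product C xs =
     {coh_class C (massey_deg xs 0 (length xs) + 1) (massey_value C xs a) | a.
        defining_system C xs a}"

definition massey_defined :: "('a::ab_group_add) dga \<Rightarrow> (int \<times> 'a set) list \<Rightarrow> bool" where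
  "massey_defined C xs \<longleftrightarrow> (\<exists>a. defining_system C xs a)"

definition massey_nontrivial :: "('a::ab_group_add) dga \<Rightarrow> (int \<times> 'a set) list \<Rightarrow> bool" where
  "massey_nontrivial C xs \<longleftrightarrow>
     massey_defined C xs \<and>
     coh_class C (massey_deg xs 0 (length xs) + 1) 0 \<notin> massey_product C xs"


section \<open>Free graded-commutative algebras\<close>

text \<open>A type of generators: each has a degree, and the linear order fixes the order of the
  factors in the basis monomials.\<close>

class graded_gen = linorder +
  fixes gdeg :: "'a \<Rightarrow> nat"

text \<open>
  A basis monomial is a multiset of generators in which odd generators are not repeated; it stands
  for the product of its elements in increasing order. The ambient type of formal combinations
  also contains multisets with repeated odd generators; these are excluded from the algebra
  \<open>free_gca S\<close> on the set \<open>S\<close> of generators. The multiplication of the type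
  \<open>_ \<Rightarrow>\<^sub>0 _\<close> of finitely supported functions plays no role (it has no signs).
\<close>

type_synonym 'g elt = "'g multiset \<Rightarrow>\<^sub>0 rat"

definition mdeg :: "'g::graded_gen multiset \<Rightarrow> int" where
  "mdeg p = (\<Sum>g\<in>#p. int (gdeg g))"

definition monomials :: "'g::graded_gen set \<Rightarrow> 'g multiset set" where
  "monomials S = {p. set_mset p \<subseteq> S \<and> (\<forall>g. odd (gdeg g) \<longrightarrow> count p g \<le> 1)}"

definition free_gca :: "'g::graded_gen set \<Rightarrow> 'g elt set" where
  "free_gca S = {f. Poly_Mapping.keys f \<subseteq> monomials S}"

definition free_gr :: "'g::graded_gen set \<Rightarrow> int \<Rightarrow> 'g elt set" where
  "free_gr S k = {f \<in> free_gca S. \<forall>p\<in>Poly_Mapping.keys f. mdeg p = k}"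

definition smul :: "rat \<Rightarrow> 'g elt \<Rightarrow> 'g elt" where
  "smul c f = Poly_Mapping.map (\<lambda>x. c * x) f"

text \<open>The product of the basis monomials \<open>p\<close> and \<open>q\<close> is zero if they share an odd generator;
  otherwise sorting the factors produces one sign for each pair of odd factors in the wrong
  order.\<close>

definition koszul :: "'g::graded_gen multiset \<Rightarrow> 'g multiset \<Rightarrow> rat" where
  "koszul p q =
     (if \<exists>g. odd (gdeg g) \<and> g \<in># p \<and> g \<in># q then 0
      else (- 1) ^ card {(x, y). x \<in># p \<and> y \<in># q \<and> odd (gdeg x) \<and> odd (gdeg y) \<and> y < x})"

definition gmul :: "'g::graded_gen elt \<Rightarrow> 'g elt \<Rightarrow> 'g elt" (infixl "\<odot>" 70) where
  "f \<odot> h = (\<Sum>p\<in>Poly_Mapping.keys f. \<Sum>q\<in>Poly_Mapping.keys h.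
     Poly_Mapping.single (p + q) (Poly_Mapping.lookup f p * Poly_Mapping.lookup h q * koszul p q))"

definition g_one :: "'g elt" where
  "g_one = Poly_Mapping.single {#} 1"

definition gvar :: "'g \<Rightarrow> 'g elt" where
  "gvar g = Poly_Mapping.single {#g#} 1"

text \<open>\<open>deriv_ext \<delta>\<close> is the derivation of degree \<open>1\<close> with values \<open>\<delta>\<close> on the generators: it
  is given by the graded Leibniz rule on the sorted words, and extended linearly.\<close>

fun deriv_word :: "('g::graded_gen \<Rightarrow> 'g elt) \<Rightarrow> 'g list \<Rightarrow> 'g elt" where
  "deriv_word \<delta> [] = 0"
| "deriv_word \<delta> (g # gs) =
     \<delta> g \<odot> foldr (\<lambda>h w. gvar h \<odot> w) gs g_one + smul ((- 1) ^ gdeg g) (gvar g \<odot> deriv_word \<delta> gs)"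

definition deriv_ext :: "('g::graded_gen \<Rightarrow> 'g elt) \<Rightarrow> 'g elt \<Rightarrow> 'g elt" where
  "deriv_ext \<delta> f =
     (\<Sum>p\<in>Poly_Mapping.keys f.
        smul (Poly_Mapping.lookup f p) (deriv_word \<delta> (sorted_list_of_multiset p)))"

definition free_dga :: "'g::graded_gen set \<Rightarrow> ('g \<Rightarrow> 'g elt) \<Rightarrow> 'g elt dga" where
  "free_dga S \<delta> = \<lparr>gr = free_gr S, scal = smul, mul = gmul, diff = deriv_ext \<delta>\<rparr>"


section \<open>Poincare dualization\<close>

definition sgn_int :: "int \<Rightarrow> rat" where
  "sgn_int k = (if even k then 1 else - 1)"

definition degrees :: "'g::graded_gen elt \<Rightarrow> int set" where
  "degrees f = mdeg ` Poly_Mapping.keys f"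

definition hcomp :: "int \<Rightarrow> 'g::graded_gen elt \<Rightarrow> 'g elt" where
  "hcomp k f = (\<Sum>p\<in>{p \<in> Poly_Mapping.keys f. mdeg p = k}.
     Poly_Mapping.single p (Poly_Mapping.lookup f p))"

text \<open>
  A linear functional on the homogeneous piece of degree \<open>n - k\<close> of \<open>free_gca S\<close> is
  extended by zero to the other pieces. Functionals are total functions of the ambient type, hence
  required to vanish outside \<open>free_gca S\<close>, so that equality is equality of functionals.
\<close>

definition dual_gr ::
    "nat \<Rightarrow> 'g::graded_gen set \<Rightarrow> int \<Rightarrow> ('g elt \<Rightarrow> rat) set" where
  "dual_gr n S k = {\<phi>.
     (\<forall>x\<in>free_gca S. \<forall>y\<in>free_gca S. \<phi> (x + y) = \<phi> x + \<phi> y) \<and>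
     (\<forall>c. \<forall>x\<in>free_gca S. \<phi> (smul c x) = c * \<phi> x) \<and>
     (\<forall>j. j \<noteq> int n - k \<longrightarrow> (\<forall>x\<in>free_gr S j. \<phi> x = 0)) \<and>
     (\<forall>x. x \<notin> free_gca S \<longrightarrow> \<phi> x = 0)}"

text \<open>
  The three operations below are stated for arbitrary, not necessarily homogeneous, arguments.
  The component of \<open>\<phi>\<close> of degree \<open>k\<close> is its restriction to the elements of
  degree \<open>l = n - k\<close>, which explains the signs: they are
  \<open>(d \<phi>)(y) = (-1)\<^bsup>|\<phi>|-1\<^esup> \<phi>(dy)\<close> and
  \<open>(x \<phi>)(y) = (-1)\<^bsup>|x||\<phi>|\<^esup> \<phi>(xy)\<close>
  on homogeneous \<open>x\<close> and \<open>\<phi>\<close>.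
\<close>

definition dual_diff ::
    "nat \<Rightarrow> 'g::graded_gen set \<Rightarrow> ('g \<Rightarrow> 'g elt) \<Rightarrow> ('g elt \<Rightarrow> rat) \<Rightarrow> ('g elt \<Rightarrow> rat)" where
  "dual_diff n S \<delta> \<phi> = (\<lambda>y. if y \<in> free_gca S then
     (\<Sum>l\<in>degrees (deriv_ext \<delta> y). sgn_int (int n - l - 1) * \<phi> (hcomp l (deriv_ext \<delta> y)))
     else 0)"

definition left_act ::
    "nat \<Rightarrow> 'g::graded_gen set \<Rightarrow> 'g elt \<Rightarrow> ('g elt \<Rightarrow> rat) \<Rightarrow> ('g elt \<Rightarrow> rat)" where
  "left_act n S x \<phi> = (\<lambda>y. if y \<in> free_gca S then
     (\<Sum>j\<in>degrees x. \<Sum>l\<in>degrees (hcomp j x \<odot> y).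
        sgn_int (j * (int n - l)) * \<phi> (hcomp l (hcomp j x \<odot> y)))
     else 0)"

definition right_act ::
    "'g::graded_gen set \<Rightarrow> ('g elt \<Rightarrow> rat) \<Rightarrow> 'g elt \<Rightarrow> ('g elt \<Rightarrow> rat)" where
  "right_act S \<phi> x = (\<lambda>y. if y \<in> free_gca S then \<phi> (x \<odot> y) else 0)"

definition poincare_dualization ::
    "nat \<Rightarrow> 'g::graded_gen set \<Rightarrow> ('g \<Rightarrow> 'g elt) \<Rightarrow> ('g elt \<times> ('g elt \<Rightarrow> rat)) dga" where
  "poincare_dualization n S \<delta> = \<lparr>
     gr = (\<lambda>k. free_gr S k \<times> dual_gr n S k),
     scal = (\<lambda>c (x, \<phi>). (smul c x, \<lambda>y. c * \<phi> y)),
     mul = (\<lambda>(x, \<phi>) (x', \<phi>'). (x \<odot> x', left_act n S x \<phi>' + right_act S \<phi> x')),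
     diff = (\<lambda>(x, \<phi>). (deriv_ext \<delta> x, dual_diff n S \<delta> \<phi>))\<rparr>"

text \<open>The functional dual to the basis monomial \<open>p\<close>.\<close>

definition hat :: "'g::graded_gen set \<Rightarrow> 'g multiset \<Rightarrow> ('g elt \<Rightarrow> rat)" where
  "hat S p = (\<lambda>y. if y \<in> free_gca S then Poly_Mapping.lookup y p else 0)"


section \<open>The algebras A and B\<close>

text \<open>\<open>NewV k i\<close> and \<open>NewW k i\<close> are the generators of degree \<open>k\<close> introduced in the
  inductive steps. The types of indices are countable, which is no restriction: the cohomology
  to be killed has finite dimension in each degree.\<close>

datatype gen =
    GX | GY | Ga | Gb | Gc | Ge | Gf | Gh | Gi
  | Galpha | Ggamma | SXalpha | SYalpha | SXgamma | SYgamma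
  | T1 | T2 | T3 | T4 | T5 | T6 | T7 | T8 | T9
  | NewV nat nat | NewW nat nat

fun gen_code :: "gen \<Rightarrow> nat" where
  "gen_code GX = 0"
| "gen_code GY = 1"
| "gen_code Ga = 2"
| "gen_code Gb = 3"
| "gen_code Gc = 4"
| "gen_code Ge = 5"
| "gen_code Gf = 6"
| "gen_code Gh = 7"
| "gen_code Gi = 8"
| "gen_code Galpha = 9"
| "gen_code Ggamma = 10"
| "gen_code SXalpha = 11"
| "gen_code SYalpha = 12"
| "gen_code SXgamma = 13"
| "gen_code SYgamma = 14"
| "gen_code T1 = 15"
| "gen_code T2 = 16"
| "gen_code T3 = 17"
| "gen_code T4 = 18"
| "gen_code T5 = 19"
| "gen_code T6 = 20"
| "gen_code T7 = 21"
| "gen_code T8 = 22"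
| "gen_code T9 = 23"
| "gen_code (NewV k i) = 24 + 2 * prod_encode (k, i)"
| "gen_code (NewW k i) = 25 + 2 * prod_encode (k, i)"

lemma gen_code_new_neq: "24 + 2 * (m::nat) \<noteq> 25 + 2 * n" "25 + 2 * (m::nat) \<noteq> 24 + 2 * n"
  by presburger+

lemma inj_gen_code: "gen_code x = gen_code y \<Longrightarrow> x = y"
  using gen_code_new_neq by (cases x; cases y) (simp_all)

instantiation gen :: graded_gen
begin

definition less_eq_gen :: "gen \<Rightarrow> gen \<Rightarrow> bool" where
  "x \<le> y \<longleftrightarrow> gen_code x \<le> gen_code y"

definition less_gen :: "gen \<Rightarrow> gen \<Rightarrow> bool" where
  "x < y \<longleftrightarrow> gen_code x < gen_code y"

fun gdeg_gen :: "gen \<Rightarrow> nat" where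
  "gdeg_gen GX = 2"
| "gdeg_gen GY = 2"
| "gdeg_gen Ga = 3"
| "gdeg_gen Gb = 3"
| "gdeg_gen Gc = 3"
| "gdeg_gen Ge = 4"
| "gdeg_gen Gf = 4"
| "gdeg_gen Gh = 5"
| "gdeg_gen Gi = 5"
| "gdeg_gen Galpha = 3"
| "gdeg_gen Ggamma = 3"
| "gdeg_gen SXalpha = 4"
| "gdeg_gen SYalpha = 4"
| "gdeg_gen SXgamma = 4"
| "gdeg_gen SYgamma = 4"
| "gdeg_gen T1 = 5"
| "gdeg_gen T2 = 5"
| "gdeg_gen T3 = 5"
| "gdeg_gen T4 = 5"
| "gdeg_gen T5 = 5"
| "gdeg_gen T6 = 5"
| "gdeg_gen T7 = 5"
| "gdeg_gen T8 = 5"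
| "gdeg_gen T9 = 5"
| "gdeg_gen (NewV k i) = k"
| "gdeg_gen (NewW k i) = k"

instance
  by standard (auto simp: less_eq_gen_def less_gen_def intro: inj_gen_code)

end

definition gen_m :: "gen elt" where
  "gen_m = gvar GY \<odot> gvar Ge + gvar Ga \<odot> gvar Gc + gvar GX \<odot> gvar Gf"

text \<open>Values of the differential on the generators; \<open>zV k i\<close> and \<open>zW k i\<close> are the chosen
  cocycles that \<open>NewV k i\<close> and \<open>NewW k i\<close> kill.\<close>

fun d_gen :: "(nat \<Rightarrow> nat \<Rightarrow> gen elt) \<Rightarrow> (nat \<Rightarrow> nat \<Rightarrow> gen elt) \<Rightarrow> gen \<Rightarrow> gen elt" where
  "d_gen zV zW GX = 0"
| "d_gen zV zW GY = 0"
| "d_gen zV zW Ga = gvar GX \<odot> gvar GX"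
| "d_gen zV zW Gb = gvar GX \<odot> gvar GY"
| "d_gen zV zW Gc = gvar GY \<odot> gvar GY"
| "d_gen zV zW Ge = gvar GY \<odot> gvar Ga - gvar GX \<odot> gvar Gb"
| "d_gen zV zW Gf = gvar GY \<odot> gvar Gb - gvar GX \<odot> gvar Gc"
| "d_gen zV zW Gh = gvar GX \<odot> gvar Ge + gvar Ga \<odot> gvar Gb"
| "d_gen zV zW Gi = gvar GY \<odot> gvar Gf + gvar Gb \<odot> gvar Gc"
| "d_gen zV zW (NewV k i) = zV k i"
| "d_gen zV zW Galpha = 0"
| "d_gen zV zW Ggamma = 0"
| "d_gen zV zW SXalpha = gvar GX \<odot> gvar Galpha"
| "d_gen zV zW SYalpha = gvar GY \<odot> gvar Galpha"
| "d_gen zV zW SXgamma = gvar GX \<odot> gvar Ggamma"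
| "d_gen zV zW SYgamma = gvar GY \<odot> gvar Ggamma"
| "d_gen zV zW T1 = gen_m - gvar Galpha \<odot> gvar Ggamma"
| "d_gen zV zW T2 = gvar GY \<odot> gvar SXalpha - gvar GX \<odot> gvar SYalpha"
| "d_gen zV zW T3 = gvar GY \<odot> gvar SXgamma - gvar GX \<odot> gvar SYgamma"
| "d_gen zV zW T4 = gvar Ga \<odot> gvar Galpha - gvar GX \<odot> gvar SXalpha"
| "d_gen zV zW T5 = gvar Gb \<odot> gvar Galpha - gvar GX \<odot> gvar SYalpha"
| "d_gen zV zW T6 = gvar Gc \<odot> gvar Galpha - gvar GY \<odot> gvar SYalpha"
| "d_gen zV zW T7 = gvar Ga \<odot> gvar Ggamma - gvar GX \<odot> gvar SXgamma"
| "d_gen zV zW T8 = gvar Gb \<odot> gvar Ggamma - gvar GX \<odot> gvar SYgamma"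
| "d_gen zV zW T9 = gvar Gc \<odot> gvar Ggamma - gvar GY \<odot> gvar SYgamma"
| "d_gen zV zW (NewW k i) = zW k i"

definition V_gens :: "(nat \<Rightarrow> nat set) \<Rightarrow> gen set" where
  "V_gens I = {GX, GY, Ga, Gb, Gc, Ge, Gf, Gh, Gi} \<union> {NewV k i | k i. k \<ge> 6 \<and> i \<in> I k}"

definition W_gens :: "(nat \<Rightarrow> nat set) \<Rightarrow> gen set" where
  "W_gens J =
     {Galpha, Ggamma, SXalpha, SYalpha, SXgamma, SYgamma, T1, T2, T3, T4, T5, T6, T7, T8, T9} \<union>
     {NewW k i | k i. k \<ge> 6 \<and> i \<in> J k}"

text \<open>
  The inductive steps: for each \<open>k \<ge> 6\<close>, the new generators of degree \<open>k\<close> correspond to a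
  basis of the cohomology in degree \<open>k + 1\<close> of the algebra on the generators of lower degree,
  where for \<open>B\<close> ``lower degree'' refers to \<open>W\<close> only, over all of \<open>A\<close>. The differentials on the
  algebras of stage \<open>k\<close> depend only on the cocycles chosen at the previous stages.
\<close>

definition A_construction ::
    "(nat \<Rightarrow> nat set) \<Rightarrow> (nat \<Rightarrow> nat \<Rightarrow> gen elt) \<Rightarrow> (nat \<Rightarrow> nat \<Rightarrow> gen elt) \<Rightarrow> bool" where
  "A_construction I zV zW \<longleftrightarrow>
     (\<forall>k\<ge>6. represents_basis
        (free_dga {g \<in> V_gens I. gdeg g < k} (d_gen zV zW)) (int k + 1) (I k) (zV k))"

definition B_construction ::
    "(nat \<Rightarrow> nat set) \<Rightarrow> (nat \<Rightarrow> nat \<Rightarrow> gen elt) \<Rightarrow>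
     (nat \<Rightarrow> nat set) \<Rightarrow> (nat \<Rightarrow> nat \<Rightarrow> gen elt) \<Rightarrow> bool" where
  "B_construction I zV J zW \<longleftrightarrow>
     A_construction I zV zW \<and>
     (\<forall>k\<ge>6. represents_basis
        (free_dga (V_gens I \<union> {g \<in> W_gens J. gdeg g < k}) (d_gen zV zW))
        (int k + 1) (J k) (zW k))"

definition B_gens :: "(nat \<Rightarrow> nat set) \<Rightarrow> (nat \<Rightarrow> nat set) \<Rightarrow> gen set" where
  "B_gens I J = V_gens I \<union> W_gens J"

definition PB ::
    "nat \<Rightarrow> (nat \<Rightarrow> nat set) \<Rightarrow> (nat \<Rightarrow> nat \<Rightarrow> gen elt) \<Rightarrow>
     (nat \<Rightarrow> nat set) \<Rightarrow> (nat \<Rightarrow> nat \<Rightarrow> gen elt) \<Rightarrow> (gen elt \<times> (gen elt \<Rightarrow> rat)) dga" where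
  "PB n I zV J zW = poincare_dualization n (B_gens I J) (d_gen zV zW)"

text \<open>The two basis monomials that are dualized are the products with the factors in the
  order as written.\<close>

lemma basis_monomial_Y_e: "gvar GY \<odot> gvar Ge = Poly_Mapping.single {#GY, Ge#} 1"
  proof -
  have *: "{(x, y). x = GY \<and> y = Ge \<and> odd (gdeg x) \<and> odd (gdeg y) \<and> y < x} = {}"
    by auto
  show ?thesis
    unfolding gmul_def gvar_def koszul_def by (simp add: * add_mset_commute)
qed

lemma basis_monomial_alpha_gamma:
  "gvar Galpha \<odot> gvar Ggamma = Poly_Mapping.single {#Galpha, Ggamma#} 1"
proof -
  have *: "{(x, y). x = Galpha \<and> y = Ggamma \<and> odd (gdeg x) \<and> odd (gdeg y) \<and> y < x} = {}"
    by (auto simp: less_gen_def)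
  show ?thesis
    by (simp add: gmul_def gvar_def koszul_def * add_mset_commute)
qed

end

(*
  A cocycle of degree at least 7 in B is exact, so in any defining system a the parts in B of
  a_34, a_24, a_14 can be removed by a change of the system that alters its value by a coboundary.
  What remains are functionals Phi, psi, theta on B^6, B^5, B^4. Evaluating the equation for
  d theta on alpha and gamma forces a_13 = -c. Evaluating the value of the product on X and using
  the equations for d psi and d theta on e and a turns it into
  Phi(Ye + ac + Xf) = Phi(m) = Phi(alpha gamma) = 1, since Phi is closed and m - alpha gamma is
  exact. A coboundary vanishes on the cocycle X, so the value is not exact.
*)
theory Submission
  imports Defs
begin

section \<open>Free graded-commutative algebras\<close>

text \<open>The bound n >= 12 is what exactness asks for: the parts of \<open>a 2 4\<close> and
  \<open>a 1 4\<close> in B have degrees n - 5 and n - 4. These parts need not be closed, because a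
  representative of the last class may have an exact part D u in B; they become closed after adding
  terms built from u. The value has degree n - 2, so its dual part is a functional on the degree 2
  piece, spanned by X and Y; this is why a single evaluation at X can decide. The generators t_i act
  as test elements, since \<Phi> vanishes on their boundaries v_i. From v_1 comes \<Phi>(m) =
  \<Phi>(\<alpha>\<gamma>). An extra multiple of \<alpha> or \<gamma> in a_13 would be seen by
  \<Phi>(\<alpha>\<gamma>) = 1 and is excluded by v_6 and v_9. The entry a_02 = -b + p \<alpha> + q
  \<gamma> keeps its freedom, but v_2 and v_3 make p and q cancel from the value. The inductive
  stages enter through exactness in degrees >= 7 and through the degrees of the chosen cocycles; the
  evaluations use generators of degree at most 5 only.\<close>

lemma lookup_smul [simp]: "Poly_Mapping.lookup (smul c f) p = c * Poly_Mapping.lookup f p"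
  by (simp add: smul_def map.rep_eq when_def)

lemma smul_zero [simp]: "smul c 0 = 0"
  and smul_zero_left [simp]: "smul 0 f = 0"
  and smul_one [simp]: "smul 1 f = f"
  and smul_smul [simp]: "smul c (smul c' f) = smul (c * c') f"
  and smul_add: "smul c (f + h) = smul c f + smul c h"
  and smul_diff: "smul c (f - h) = smul c f - smul c h"
  and smul_minus: "smul c (- f) = - smul c f"
  and smul_single [simp]: "smul c (Poly_Mapping.single p b) = Poly_Mapping.single p (c * b)"
  and smul_minus_one: "smul (- 1) f = - f"
  and smul_minus_left: "smul (- c) f = - smul c f"
  by (rule poly_mapping_eqI; simp add: lookup_add lookup_minus lookup_single when_def algebra_simps)+

lemma smul_sum: "smul c (sum f A) = (\<Sum>x\<in>A. smul c (f x))"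
  by (induction A rule: infinite_finite_induct) (auto simp: smul_add)

lemma elt_as_sum:
  fixes f :: "'g elt"
  assumes "finite A" "Poly_Mapping.keys f \<subseteq> A"
  shows "f = (\<Sum>p\<in>A. Poly_Mapping.single p (Poly_Mapping.lookup f p))"
proof (rule poly_mapping_eqI)
  fix q
  have "(\<Sum>p\<in>A. Poly_Mapping.lookup f p when p = q) = (if q \<in> A then Poly_Mapping.lookup f q else 0)"
    using assms(1) by (simp add: when_def)
  then show "Poly_Mapping.lookup f q =
      Poly_Mapping.lookup (\<Sum>p\<in>A. Poly_Mapping.single p (Poly_Mapping.lookup f p)) q"
    using assms(2) by (auto simp: lookup_sum lookup_single in_keys_iff)
qed

text \<open>Reduces a property closed under addition to monomials. \<open>K\<close> records which
  monomials may occur, so the rule also serves \<open>free_gca\<close> and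
  \<open>free_gr\<close>.\<close>

lemma elt_induct [consumes 1, case_names zero single add]:
  fixes f :: "'g elt"
  assumes "Poly_Mapping.keys f \<subseteq> K"
    and "P 0"
    and "\<And>p c. p \<in> K \<Longrightarrow> P (Poly_Mapping.single p c)"
    and "\<And>f h. P f \<Longrightarrow> P h \<Longrightarrow> P (f + h)"
  shows "P f"
proof -
  have "P (\<Sum>p\<in>A. Poly_Mapping.single p (Poly_Mapping.lookup f p))" if "finite A" "A \<subseteq> K" for A
    using that by (induction A rule: finite_induct) (auto intro: assms)
  from this[of "Poly_Mapping.keys f"] show ?thesis
    by (subst elt_as_sum[of "Poly_Mapping.keys f" f]) (use assms(1) in simp_all)
qed

text \<open>Cancellation can shrink the keys of a sum, so bilinearity is proved over a common finite
  superset of the keys.\<close>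

lemma gmul_superset:
  assumes "finite A" "Poly_Mapping.keys f \<subseteq> A" "finite B" "Poly_Mapping.keys h \<subseteq> B"
  shows "f \<odot> h = (\<Sum>p\<in>A. \<Sum>q\<in>B. Poly_Mapping.single (p + q)
     (Poly_Mapping.lookup f p * Poly_Mapping.lookup h q * koszul p q))"
proof -
  have "(\<Sum>q\<in>Poly_Mapping.keys h. Poly_Mapping.single (p + q)
     (Poly_Mapping.lookup f p * Poly_Mapping.lookup h q * koszul p q)) =
     (\<Sum>q\<in>B. Poly_Mapping.single (p + q)
     (Poly_Mapping.lookup f p * Poly_Mapping.lookup h q * koszul p q))" for p
    using assms by (intro sum.mono_neutral_left) (auto simp: in_keys_iff)
  then show ?thesis
    unfolding gmul_def using assms
    by (simp, intro sum.mono_neutral_left) (auto simp: in_keys_iff)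
qed

lemma gmul_single_single [simp]:
  "Poly_Mapping.single p b \<odot> Poly_Mapping.single q c = Poly_Mapping.single (p + q) (b * c * koszul p q)"
  by (subst gmul_superset[of "{p}" _ "{q}"]) auto

lemma gmul_add_left: "(f + f') \<odot> h = f \<odot> h + f' \<odot> h"
proof -
  let ?A = "Poly_Mapping.keys f \<union> Poly_Mapping.keys f'"
  have "finite ?A" "Poly_Mapping.keys (f + f') \<subseteq> ?A"
    using keys_add[of f f'] by auto
  then show ?thesis
    by (simp add: gmul_superset[of ?A _ "Poly_Mapping.keys h"] lookup_add single_add
        distrib_right sum.distrib)
qed

lemma gmul_add_right: "h \<odot> (f + f') = h \<odot> f + h \<odot> f'"
proof -
  let ?A = "Poly_Mapping.keys f \<union> Poly_Mapping.keys f'"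
  have "finite ?A" "Poly_Mapping.keys (f + f') \<subseteq> ?A"
    using keys_add[of f f'] by auto
  then show ?thesis
    by (simp add: gmul_superset[of "Poly_Mapping.keys h" _ ?A] lookup_add single_add
        distrib_left distrib_right sum.distrib)
qed

lemma keys_smul: "Poly_Mapping.keys (smul c f) \<subseteq> Poly_Mapping.keys f"
  by (auto simp: in_keys_iff)

lemma gmul_smul_left [simp]: "smul c f \<odot> h = smul c (f \<odot> h)"
  by (simp add: gmul_superset[of "Poly_Mapping.keys f" _ "Poly_Mapping.keys h"] keys_smul smul_sum
      mult.assoc)

lemma gmul_smul_right [simp]: "h \<odot> smul c f = smul c (h \<odot> f)"
  by (simp add: gmul_superset[of "Poly_Mapping.keys h" _ "Poly_Mapping.keys f"] keys_smul smul_sum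
      mult.assoc mult.left_commute)

lemma gmul_zero_left [simp]: "0 \<odot> h = 0"
  and gmul_zero_right [simp]: "h \<odot> 0 = 0"
  by (simp_all add: gmul_def)

lemma gmul_minus_left [simp]: "(- f) \<odot> h = - (f \<odot> h)"
  using gmul_smul_left[of "-1" f h] by (simp add: smul_minus_one)

lemma gmul_minus_right [simp]: "h \<odot> (- f) = - (h \<odot> f)"
  using gmul_smul_right[of h "-1" f] by (simp add: smul_minus_one)

lemma gmul_diff_left: "(f - f') \<odot> h = f \<odot> h - f' \<odot> h"
  using gmul_add_left[of f "- f'" h] by simp

lemma gmul_diff_right: "h \<odot> (f - f') = h \<odot> f - h \<odot> f'"
  using gmul_add_right[of h f "- f'"] by simp

lemmas gmul_distribs = gmul_add_left gmul_add_right gmul_diff_left gmul_diff_right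

section \<open>Koszul signs and associativity\<close>

definition inversions :: "'g::graded_gen multiset \<Rightarrow> 'g multiset \<Rightarrow> ('g \<times> 'g) set" where
  "inversions p q = {(x, y). x \<in># p \<and> y \<in># q \<and> odd (gdeg x) \<and> odd (gdeg y) \<and> y < x}"

definition share_odd :: "'g::graded_gen multiset \<Rightarrow> 'g multiset \<Rightarrow> bool" where
  "share_odd p q \<longleftrightarrow> (\<exists>g. odd (gdeg g) \<and> g \<in># p \<and> g \<in># q)"

lemma koszul_alt: "koszul p q = (if share_odd p q then 0 else (- 1) ^ card (inversions p q))"
  by (simp add: koszul_def inversions_def share_odd_def conj_ac)

lemma finite_inversions [simp]: "finite (inversions p q)"
  by (rule finite_subset[of _ "set_mset p \<times> set_mset q"]) (auto simp: inversions_def)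

lemma share_odd_plus [simp]:
  "share_odd (p + q) r \<longleftrightarrow> share_odd p r \<or> share_odd q r"
  "share_odd p (q + r) \<longleftrightarrow> share_odd p q \<or> share_odd p r"
  by (auto simp: share_odd_def)

text \<open>\<open>inversions\<close> is a set, so an odd factor common to p and q would be counted
  only once; the hypothesis makes the union disjoint.\<close>

lemma card_inversions_plus_left:
  assumes "\<not> share_odd p q"
  shows "card (inversions (p + q) r) = card (inversions p r) + card (inversions q r)"
proof -
  have "inversions (p + q) r = inversions p r \<union> inversions q r" "inversions p r \<inter> inversions q r = {}"
    using assms by (auto simp: inversions_def share_odd_def)
  then show ?thesis by (simp add: card_Un_disjoint)
qed

lemma card_inversions_plus_right:
  assumes "\<not> share_odd q r"
  shows "card (inversions p (q + r)) = card (inversions p q) + card (inversions p r)"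
proof -
  have "inversions p (q + r) = inversions p q \<union> inversions p r" "inversions p q \<inter> inversions p r = {}"
    using assms by (auto simp: inversions_def share_odd_def)
  then show ?thesis by (simp add: card_Un_disjoint)
qed

text \<open>Both sides vanish as soon as two of p, q, r share an odd generator. Otherwise both
  exponents are the total number of inversions among the three pairs (p, q), (p, r), (q, r).\<close>

lemma koszul_cocycle: "koszul p q * koszul (p + q) r = koszul q r * koszul p (q + r)"
  by (simp add: koszul_alt card_inversions_plus_left card_inversions_plus_right power_add)

lemma gmul_assoc: "(f \<odot> h) \<odot> k = f \<odot> (h \<odot> k)"
proof (induction f rule: elt_induct[OF subset_UNIV, case_names zero single add])
  case (single p b)
  show ?case
  proof (induction h rule: elt_induct[OF subset_UNIV, case_names zero single add])
    case (single q c)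
    show ?case
    proof (induction k rule: elt_induct[OF subset_UNIV, case_names zero single add])
      case (single r d)
      show ?case
        using koszul_cocycle[of p q r] by (simp add: add.assoc) (simp add: mult_ac)
    qed (auto simp: gmul_distribs)
  qed (auto simp: gmul_distribs)
qed (auto simp: gmul_distribs)

section \<open>Grading and closure properties\<close>

lemma mdeg_empty [simp]: "mdeg {#} = 0"
  and mdeg_plus [simp]: "mdeg (p + q) = mdeg p + mdeg q"
  and mdeg_add_mset [simp]: "mdeg (add_mset g p) = int (gdeg g) + mdeg p"
  by (simp_all add: mdeg_def)

lemma free_gr_alt: "free_gr S k = {f. Poly_Mapping.keys f \<subseteq> {p \<in> monomials S. mdeg p = k}}"
  by (auto simp: free_gr_def free_gca_def)

lemma free_gr_induct [consumes 1, case_names zero single add]: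
  assumes "f \<in> free_gr S k"
    and "P 0"
    and "\<And>p c. p \<in> monomials S \<Longrightarrow> mdeg p = k \<Longrightarrow> P (Poly_Mapping.single p c)"
    and "\<And>f h. P f \<Longrightarrow> P h \<Longrightarrow> P (f + h)"
  shows "P f"
  using assms by (intro elt_induct[of f "{p \<in> monomials S. mdeg p = k}" P]) (auto simp: free_gr_alt)

lemma keys_uminus [simp]: "Poly_Mapping.keys (- (f :: 'g elt)) = Poly_Mapping.keys f"
  by (auto simp: in_keys_iff)

lemma free_gr_zero [simp]: "0 \<in> free_gr S k"
  and free_gr_add: "f \<in> free_gr S k \<Longrightarrow> h \<in> free_gr S k \<Longrightarrow> f + h \<in> free_gr S k"
  and free_gr_smul: "f \<in> free_gr S k \<Longrightarrow> smul c f \<in> free_gr S k"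
  and free_gr_uminus: "f \<in> free_gr S k \<Longrightarrow> - f \<in> free_gr S k"
  using keys_add[of f h] keys_smul[of c f] by (force simp: free_gr_alt)+

lemma free_gr_diff: "f \<in> free_gr S k \<Longrightarrow> h \<in> free_gr S k \<Longrightarrow> f - h \<in> free_gr S k"
  using free_gr_add[OF _ free_gr_uminus, of f S k h] by simp

lemma free_gr_sum: "(\<And>x. x \<in> A \<Longrightarrow> f x \<in> free_gr S k) \<Longrightarrow> sum f A \<in> free_gr S k"
  by (induction A rule: infinite_finite_induct) (auto intro: free_gr_add)

lemma free_gca_zero [simp]: "0 \<in> free_gca S"
  and free_gca_add: "f \<in> free_gca S \<Longrightarrow> h \<in> free_gca S \<Longrightarrow> f + h \<in> free_gca S"
  and free_gca_smul: "f \<in> free_gca S \<Longrightarrow> smul c f \<in> free_gca S"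
  and free_gca_uminus: "f \<in> free_gca S \<Longrightarrow> - f \<in> free_gca S"
  using keys_add[of f h] keys_smul[of c f] by (force simp: free_gca_def)+

lemma free_gr_imp_free_gca: "f \<in> free_gr S k \<Longrightarrow> f \<in> free_gca S"
  by (simp add: free_gr_def)

lemma single_in_free_gr: "p \<in> monomials S \<Longrightarrow> mdeg p = k \<Longrightarrow> Poly_Mapping.single p c \<in> free_gr S k"
  by (auto simp: free_gr_alt)

lemma single_in_free_gca: "p \<in> monomials S \<Longrightarrow> Poly_Mapping.single p c \<in> free_gca S"
  by (auto simp: free_gca_def)

lemma singleton_in_monomials [simp]: "{#g#} \<in> monomials S \<longleftrightarrow> g \<in> S"
  by (auto simp: monomials_def)

lemma gvar_in_free_gr: "g \<in> S \<Longrightarrow> k = int (gdeg g) \<Longrightarrow> gvar g \<in> free_gr S k"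
  by (auto simp: gvar_def intro: single_in_free_gr)

lemma monomials_plus:
  assumes "p \<in> monomials S" "q \<in> monomials S" "\<not> share_odd p q"
  shows "p + q \<in> monomials S"
proof -
  have "count (p + q) g \<le> 1" if "odd (gdeg g)" for g
  proof (cases "g \<in># p")
    case True
    then have "g \<notin># q" using assms(3) that by (auto simp: share_odd_def)
    then show ?thesis using assms(1) that by (simp add: monomials_def not_in_iff)
  next
    case False
    then show ?thesis using assms(2) that by (simp add: monomials_def not_in_iff)
  qed
  then show ?thesis using assms(1,2) by (auto simp: monomials_def)
qed

lemma gmul_in_free_gr:
  assumes "f \<in> free_gr S i" "h \<in> free_gr S j" "k = i + j"
  shows "f \<odot> h \<in> free_gr S k"
  using assms(1)
proof (induction f rule: free_gr_induct)
  case (single p b)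
  note p = this
  from assms(2) show ?case
  proof (induction h rule: free_gr_induct)
    case (single q c)
    show ?case
    proof (cases "share_odd p q")
      case True
      then show ?thesis by (simp add: koszul_alt)
    next
      case False
      then show ?thesis using single p assms(3) by (auto intro!: single_in_free_gr monomials_plus)
    qed
  qed (auto simp: gmul_distribs intro: free_gr_add)
qed (auto simp: gmul_distribs intro: free_gr_add)

section \<open>Graded commutativity\<close>

lemma sgn_int_add: "sgn_int (i + j) = sgn_int i * sgn_int j"
  and sgn_int_of_nat: "sgn_int (int m) = (- 1) ^ m"
  and sgn_int_square [simp]: "sgn_int i * sgn_int i = 1"
  and sgn_int_nonzero [simp]: "sgn_int i \<noteq> 0"
  by (auto simp: sgn_int_def)

lemma sgn_int_cancel [simp]: "sgn_int i * (sgn_int i * c) = c"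
  by (simp flip: mult.assoc)

definition odd_part :: "'g::graded_gen multiset \<Rightarrow> 'g set" where
  "odd_part p = {g. g \<in># p \<and> odd (gdeg g)}"

lemma finite_odd_part [simp]: "finite (odd_part p)"
  by (rule finite_subset[of _ "set_mset p"]) (auto simp: odd_part_def)

lemma monomials_subset:
  assumes "p \<in> monomials S" "q \<subseteq># p"
  shows "q \<in> monomials S"
proof -
  have "count q g \<le> count p g" for g
    using assms(2) by (rule mset_subset_eq_count)
  then show ?thesis
    using assms(1) set_mset_mono[OF assms(2)] unfolding monomials_def by (blast intro: order_trans)
qed

text \<open>Links signs given by degrees to signs given by counting odd factors. Without repetition
  of odd generators, \<open>odd_part p\<close> counts each odd factor exactly once.\<close>

lemma mdeg_parity:
  assumes "p \<in> monomials S"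
  shows "even (mdeg p) \<longleftrightarrow> even (card (odd_part p))"
  using assms
proof (induction p)
  case empty
  then show ?case by (simp add: odd_part_def)
next
  case (add g p)
  have p: "p \<in> monomials S"
    using add.prems by (rule monomials_subset) simp
  show ?case
  proof (cases "odd (gdeg g)")
    case True
    then have "g \<notin># p" using add.prems by (auto simp: monomials_def not_in_iff)
    then have "odd_part (add_mset g p) = insert g (odd_part p)" "g \<notin> odd_part p"
      using True by (auto simp: odd_part_def)
    then show ?thesis using True add.IH[OF p] by simp
  next
    case False
    then have "odd_part (add_mset g p) = odd_part p" by (auto simp: odd_part_def)
    then show ?thesis using False add.IH[OF p] by simp
  qed
qed

text \<open>If no odd generator is shared, each pair of odd factors, one from p and one from q, is
  an inversion in exactly one of the two orders. The two inversion counts therefore add up to the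
  product of the numbers of odd factors.\<close>

lemma koszul_commute:
  assumes "p \<in> monomials S" "q \<in> monomials S"
  shows "koszul p q = sgn_int (mdeg p * mdeg q) * koszul q p"
proof (cases "share_odd p q")
  case True
  then have "share_odd q p" by (auto simp: share_odd_def)
  with True show ?thesis by (simp add: koszul_alt)
next
  case False
  then have *: "\<not> share_odd q p" by (auto simp: share_odd_def)
  have "odd_part p \<times> odd_part q = inversions p q \<union> prod.swap ` inversions q p"
    using False by (force simp: odd_part_def inversions_def share_odd_def image_iff not_less_iff_gr_or_eq)
  moreover have "inversions p q \<inter> prod.swap ` inversions q p = {}"
    by (auto simp: inversions_def)
  moreover have "card (prod.swap ` inversions q p) = card (inversions q p)"
    by (rule card_image) (auto simp: inj_on_def)
  ultimately have "card (odd_part p) * card (odd_part q) = card (inversions p q) + card (inversions q p)"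
    by (simp add: card_cartesian_product[symmetric] card_Un_disjoint)
  moreover have "sgn_int (mdeg p * mdeg q) = (-1) ^ (card (odd_part p) * card (odd_part q))"
    using mdeg_parity[OF assms(1)] mdeg_parity[OF assms(2)] by (simp add: sgn_int_def)
  ultimately show ?thesis
    using False * by (simp add: koszul_alt power_add)
qed

lemma gmul_commute:
  assumes "f \<in> free_gr S i" "h \<in> free_gr S j"
  shows "f \<odot> h = smul (sgn_int (i * j)) (h \<odot> f)"
  using assms(1)
proof (induction f rule: free_gr_induct)
  case (single p b)
  note p = this
  from assms(2) show ?case
  proof (induction h rule: free_gr_induct)
    case (single q c)
    then show ?case using koszul_commute[OF p(1) single(1)] p by (simp add: add.commute mult_ac)
  qed (auto simp: gmul_distribs smul_add)
qed (auto simp: gmul_distribs smul_add)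

lemma gmul_commute_even:
  assumes "f \<in> free_gr S i" "h \<in> free_gr S j" "even i \<or> even j"
  shows "f \<odot> h = h \<odot> f"
  using gmul_commute[OF assms(1,2)] assms(3) by (auto simp: sgn_int_def)

lemma free_gca_gmul:
  assumes "f \<in> free_gca S" "h \<in> free_gca S"
  shows "f \<odot> h \<in> free_gca S"
proof -
  have *: "Poly_Mapping.single p b \<odot> Poly_Mapping.single q c \<in> free_gca S"
    if "p \<in> monomials S" "q \<in> monomials S" for p q b c
    using that gmul_in_free_gr[OF single_in_free_gr single_in_free_gr]
    by (blast intro: free_gr_imp_free_gca)
  have **: "f \<odot> Poly_Mapping.single q c \<in> free_gca S" if "q \<in> monomials S" for q c
    using assms(1)[unfolded free_gca_def mem_Collect_eq] that
    by (induction f rule: elt_induct) (simp_all add: * gmul_distribs free_gca_add del: gmul_single_single)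
  show ?thesis
    using assms(2)[unfolded free_gca_def mem_Collect_eq]
    by (induction h rule: elt_induct) (simp_all add: ** gmul_distribs free_gca_add)
qed

lemma gvar_in_free_gca [simp]: "gvar g \<in> free_gca S \<longleftrightarrow> g \<in> S"
  by (simp add: gvar_def free_gca_def)

lemma free_gca_diff: "f \<in> free_gca S \<Longrightarrow> h \<in> free_gca S \<Longrightarrow> f - h \<in> free_gca S"
  using free_gca_add[OF _ free_gca_uminus, of f S h] by simp

lemmas free_gca_closed =
  free_gca_add free_gca_diff free_gca_uminus free_gca_smul free_gca_gmul

lemma koszul_even [simp]:
  "\<forall>g\<in>#p. even (gdeg g) \<Longrightarrow> koszul p q = 1"
  "\<forall>g\<in>#q. even (gdeg g) \<Longrightarrow> koszul p q = 1"
proof -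
  show "koszul p q = 1" if "\<forall>g\<in>#p. even (gdeg g)"
  proof -
    have "\<not> share_odd p q" "inversions p q = {}"
      using that by (auto simp: share_odd_def inversions_def)
    then show ?thesis by (simp add: koszul_alt)
  qed
  show "koszul p q = 1" if "\<forall>g\<in>#q. even (gdeg g)"
  proof -
    have "\<not> share_odd p q" "inversions p q = {}"
      using that by (auto simp: share_odd_def inversions_def)
    then show ?thesis by (simp add: koszul_alt)
  qed
qed

section \<open>Derivations\<close>

lemma deriv_ext_superset:
  assumes "finite A" "Poly_Mapping.keys f \<subseteq> A"
  shows "deriv_ext \<delta> f =
    (\<Sum>p\<in>A. smul (Poly_Mapping.lookup f p) (deriv_word \<delta> (sorted_list_of_multiset p)))"
  unfolding deriv_ext_def using assms by (intro sum.mono_neutral_left) (auto simp: in_keys_iff)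

lemma deriv_ext_single:
  "deriv_ext \<delta> (Poly_Mapping.single p c) = smul c (deriv_word \<delta> (sorted_list_of_multiset p))"
  by (subst deriv_ext_superset[of "{p}"]) auto

lemma deriv_ext_zero [simp]: "deriv_ext \<delta> 0 = 0"
  by (simp add: deriv_ext_def)

lemma smul_add_left: "smul (b + c) f = smul b f + smul c f"
  by (rule poly_mapping_eqI) (simp add: lookup_add distrib_right)

lemma deriv_ext_add: "deriv_ext \<delta> (f + h) = deriv_ext \<delta> f + deriv_ext \<delta> h"
proof -
  let ?A = "Poly_Mapping.keys f \<union> Poly_Mapping.keys h"
  have "finite ?A" "Poly_Mapping.keys (f + h) \<subseteq> ?A"
    using keys_add[of f h] by auto
  then show ?thesis
    by (simp add: deriv_ext_superset[of ?A] lookup_add smul_add_left sum.distrib)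
qed

lemma deriv_ext_smul: "deriv_ext \<delta> (smul c f) = smul c (deriv_ext \<delta> f)"
  by (simp add: deriv_ext_superset[of "Poly_Mapping.keys f"] keys_smul smul_sum)

lemma deriv_ext_minus: "deriv_ext \<delta> (- f) = - deriv_ext \<delta> f"
  using deriv_ext_smul[of \<delta> "-1" f] by (simp add: smul_minus_one)

lemma deriv_ext_diff: "deriv_ext \<delta> (f - h) = deriv_ext \<delta> f - deriv_ext \<delta> h"
  using deriv_ext_add[of \<delta> f "- h"] by (simp add: deriv_ext_minus)

lemma deriv_ext_sum: "deriv_ext \<delta> (sum f A) = (\<Sum>x\<in>A. deriv_ext \<delta> (f x))"
  by (induction A rule: infinite_finite_induct) (auto simp: deriv_ext_add)

lemmas deriv_ext_linear = deriv_ext_add deriv_ext_diff deriv_ext_minus deriv_ext_smul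

lemma koszul_empty [simp]: "koszul {#} p = 1" "koszul p {#} = 1"
  by (simp_all add: koszul_def)

lemma gmul_one_left [simp]: "g_one \<odot> f = f"
  by (induction f rule: elt_induct[OF subset_UNIV, case_names zero single add])
    (auto simp: g_one_def gmul_distribs simp del: single_one)

lemma gmul_one_right [simp]: "f \<odot> g_one = f"
  by (induction f rule: elt_induct[OF subset_UNIV, case_names zero single add])
    (auto simp: g_one_def gmul_distribs simp del: single_one)

lemma koszul_min:
  assumes "\<forall>h\<in>#p. g \<le> h" "odd (gdeg g) \<Longrightarrow> g \<notin># p"
  shows "koszul {#g#} p = 1"
proof -
  have "\<not> share_odd {#g#} p" "inversions {#g#} p = {}"
    using assms by (auto simp: share_odd_def inversions_def)
  then show ?thesis by (simp add: koszul_alt)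
qed

lemma gvar_gmul_min:
  assumes "\<forall>h\<in>#p. g \<le> h" "odd (gdeg g) \<Longrightarrow> g \<notin># p"
  shows "gvar g \<odot> Poly_Mapping.single p c = Poly_Mapping.single (add_mset g p) c"
  using koszul_min[OF assms] by (simp add: gvar_def)

lemma odd_notin_monomial:
  assumes "add_mset g p \<in> monomials S" "odd (gdeg g)"
  shows "g \<notin># p"
proof -
  have "count (add_mset g p) g \<le> 1"
    using assms unfolding monomials_def by blast
  then show ?thesis by (simp add: not_in_iff)
qed

lemma gvar_prod_sorted:
  assumes "sorted gs" "mset gs \<in> monomials S"
  shows "foldr (\<lambda>h w. gvar h \<odot> w) gs g_one = Poly_Mapping.single (mset gs) 1"
  using assms
proof (induction gs)
  case Nil
  then show ?case by (simp add: g_one_def)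
next
  case (Cons g gs)
  have "mset gs \<in> monomials S"
    using Cons.prems(2) by (rule monomials_subset) simp
  moreover have "odd (gdeg g) \<Longrightarrow> g \<notin># mset gs"
    using Cons.prems(2) odd_notin_monomial[of g "mset gs" S] by simp
  ultimately show ?case
    using Cons gvar_gmul_min[of "mset gs" g 1] by simp
qed

text \<open>A least factor heads the sorted word, so here the Leibniz rule is the recursion of
  \<open>deriv_word\<close>. A generator in general position is reduced to this case by moving it
  past smaller ones.\<close>

lemma deriv_ext_min:
  assumes "\<forall>h\<in>#p. g \<le> h" "add_mset g p \<in> monomials S"
  shows "deriv_ext \<delta> (Poly_Mapping.single (add_mset g p) c) =
    \<delta> g \<odot> Poly_Mapping.single p c
      + smul (sgn_int (int (gdeg g))) (gvar g \<odot> deriv_ext \<delta> (Poly_Mapping.single p c))"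
proof -
  let ?gs = "sorted_list_of_multiset p"
  have "p \<in> monomials S"
    using assms(2) by (rule monomials_subset) simp
  then have "foldr (\<lambda>h w. gvar h \<odot> w) ?gs g_one = Poly_Mapping.single p 1"
    using gvar_prod_sorted[of ?gs S] by simp
  moreover have "insort g ?gs = g # ?gs"
    using assms(1) by (intro insort_is_Cons) simp
  moreover have "\<delta> g \<odot> Poly_Mapping.single p c = smul c (\<delta> g \<odot> Poly_Mapping.single p 1)"
    by (simp flip: gmul_smul_right)
  ultimately show ?thesis
    by (simp add: deriv_ext_single smul_add sgn_int_of_nat mult.commute)
qed

lemma deriv_ext_gvar [simp]: "deriv_ext \<delta> (gvar g) = \<delta> g"
  by (simp add: gvar_def deriv_ext_single g_one_def[symmetric])

lemma gmul_left_commute: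
  assumes "f \<in> free_gr S i" "h \<in> free_gr S j"
  shows "f \<odot> (h \<odot> k) = smul (sgn_int (i * j)) (h \<odot> (f \<odot> k))"
  using gmul_commute[OF assms] by (simp flip: gmul_assoc)

locale graded_derivation =
  fixes S :: "'g::graded_gen set" and \<delta> :: "'g \<Rightarrow> 'g elt"
  assumes \<delta>_degree: "g \<in> S \<Longrightarrow> \<delta> g \<in> free_gr S (int (gdeg g) + 1)"
begin

abbreviation D where "D \<equiv> deriv_ext \<delta>"

lemma D_single_in_free_gr:
  assumes "p \<in> monomials S"
  shows "D (Poly_Mapping.single p c) \<in> free_gr S (mdeg p + 1)"
  using assms
proof (induction p rule: multiset_induct_min)
  case empty
  then show ?case by (simp add: deriv_ext_single)
next
  case (add g p)
  have p: "p \<in> monomials S"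
    using add.prems by (rule monomials_subset) simp
  have g: "g \<in> S"
    using add.prems by (simp add: monomials_def)
  show ?case
    using add.IH[OF p] g p
    by (subst deriv_ext_min[OF _ add.prems])
      (auto simp: add.hyps intro!: free_gr_add free_gr_smul gmul_in_free_gr \<delta>_degree
        gvar_in_free_gr single_in_free_gr)
qed

lemma D_in_free_gr:
  assumes "f \<in> free_gr S k"
  shows "D f \<in> free_gr S (k + 1)"
  using assms
  by (induction f rule: free_gr_induct) (auto simp: deriv_ext_add intro: free_gr_add D_single_in_free_gr)

text \<open>Induction that splits off the least factor h of the monomial. Either g comes before h
  and \<open>deriv_ext_min\<close> applies, or g is moved past h.\<close>

lemma D_gvar_gmul_single:
  assumes "g \<in> S" "p \<in> monomials S"
  shows "D (gvar g \<odot> Poly_Mapping.single p c) =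
    \<delta> g \<odot> Poly_Mapping.single p c
      + smul (sgn_int (int (gdeg g))) (gvar g \<odot> D (Poly_Mapping.single p c))"
  using assms(2)
proof (induction p arbitrary: c rule: multiset_induct_min)
  case empty
  then show ?case
    by (simp add: gvar_gmul_min deriv_ext_min[of "{#}" g S] \<open>g \<in> S\<close>)
next
  case (add h p)
  let ?P = "Poly_Mapping.single p c"
  let ?m = "int (gdeg g)" and ?k = "int (gdeg h)"
  have p: "p \<in> monomials S"
    using add.prems by (rule monomials_subset) simp
  have h: "h \<in> S"
    using add.prems by (simp add: monomials_def)
  have x: "gvar g \<in> free_gr S ?m" and y: "gvar h \<in> free_gr S ?k"
    and dx: "\<delta> g \<in> free_gr S (?m + 1)" and dy: "\<delta> h \<in> free_gr S (?k + 1)"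
    using \<open>g \<in> S\<close> h by (auto intro: gvar_in_free_gr \<delta>_degree)
  have hp: "gvar h \<odot> ?P = Poly_Mapping.single (add_mset h p) c"
    using add.hyps odd_notin_monomial[OF add.prems] by (intro gvar_gmul_min) auto
  have Dhp: "D (gvar h \<odot> ?P) = \<delta> h \<odot> ?P + smul (sgn_int ?k) (gvar h \<odot> D ?P)"
    unfolding hp by (rule deriv_ext_min[OF _ add.prems]) (use add.hyps in auto)
  show ?case
  proof (cases "g \<le> h")
    case True
    then have min: "\<forall>k\<in>#add_mset h p. g \<le> k"
      using add.hyps by fastforce
    show ?thesis
    proof (cases "odd (gdeg g) \<and> g \<in># add_mset h p")
      \<comment> \<open>Here h = g is odd, so both products on the left contain a square of an odd
        generator. The two Leibniz terms cancel because \<delta> g has even degree and commutes with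
        g.\<close>
      case True
      then have "h = g"
        using \<open>g \<le> h\<close> add.hyps by (auto intro: antisym)
      have "gvar g \<odot> Poly_Mapping.single (add_mset h p) c = 0" "gvar g \<odot> gvar g = 0"
        using True by (auto simp: koszul_def gvar_def)
      moreover from this(2) have "gvar g \<odot> (gvar g \<odot> D ?P) = 0"
        by (simp flip: gmul_assoc)
      moreover have "sgn_int ?m = - 1" "sgn_int (?m * (?m + 1)) = 1"
        using True by (simp_all add: sgn_int_def)
      ultimately show ?thesis
        using hp Dhp gmul_left_commute[OF x dx] unfolding \<open>h = g\<close>
        by (simp add: gmul_distribs smul_minus_one)
    next
      case False
      then have "\<not> share_odd {#g#} (add_mset h p)"
        by (auto simp: share_odd_def)
      then have "{#g#} + add_mset h p \<in> monomials S"
        using add.prems \<open>g \<in> S\<close> by (intro monomials_plus) auto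
      then show ?thesis
        using False min by (subst gvar_gmul_min) (auto simp: add_mset_commute intro!: deriv_ext_min[where S = S])
    qed
  next
    case False
    then have "h < g" by simp
    \<comment> \<open>h precedes g and every factor of p, so \<open>deriv_ext_min\<close> covers the
      word h g p; if g is an odd factor of p, all terms vanish.\<close>
    have Dhgp: "D (gvar h \<odot> (gvar g \<odot> ?P)) =
        \<delta> h \<odot> (gvar g \<odot> ?P) + smul (sgn_int ?k) (gvar h \<odot> D (gvar g \<odot> ?P))"
    proof (cases "share_odd {#g#} p")
      case True
      then show ?thesis by (simp add: gvar_def koszul_alt)
    next
      case False
      have 1: "{#g#} + p \<in> monomials S"
        using False p \<open>g \<in> S\<close> by (intro monomials_plus) auto
      have 2: "{#h#} + ({#g#} + p) \<in> monomials S"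
        by (rule monomials_plus)
          (use 1 h \<open>h < g\<close> odd_notin_monomial[OF add.prems] in \<open>auto simp: share_odd_def\<close>)
      have 3: "\<forall>k\<in>#add_mset g p. h \<le> k"
        using \<open>h < g\<close> add.hyps by auto
      have 4: "odd (gdeg h) \<Longrightarrow> h \<notin># add_mset g p"
        using \<open>h < g\<close> odd_notin_monomial[OF add.prems] by auto
      have "gvar g \<odot> ?P = Poly_Mapping.single (add_mset g p) (c * koszul {#g#} p)"
        by (simp add: gvar_def)
      then show ?thesis
        using gvar_gmul_min[OF 3 4] deriv_ext_min[OF 3, of S \<delta>] 2
        by (simp add: add_mset_commute)
    qed
    have "D (gvar g \<odot> (gvar h \<odot> ?P)) = smul (sgn_int (?m * ?k)) (D (gvar h \<odot> (gvar g \<odot> ?P)))"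
      by (simp add: gmul_left_commute[OF x y] deriv_ext_smul)
    also have "\<dots> = smul (sgn_int (?m * ?k)) (\<delta> h \<odot> (gvar g \<odot> ?P)) +
        smul (sgn_int (?m * ?k) * sgn_int ?k) (gvar h \<odot> (\<delta> g \<odot> ?P)) +
        smul (sgn_int (?m * ?k) * sgn_int ?k * sgn_int ?m) (gvar h \<odot> (gvar g \<odot> D ?P))"
      by (simp add: Dhgp add.IH[OF p] gmul_distribs smul_add add.assoc mult.assoc)
    \<comment> \<open>Moving h past \<delta> g instead of g changes the sign by one more factor
      (-1)^|h|, since \<delta> has degree 1; this is the sign contributed by the Leibniz rule for
      h.\<close>
    also have "\<dots> = \<delta> g \<odot> (gvar h \<odot> ?P) + smul (sgn_int ?m) (gvar g \<odot> D (gvar h \<odot> ?P))"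
      unfolding Dhp
      by (simp add: gmul_left_commute[OF dx y] gmul_left_commute[OF x dy] gmul_left_commute[OF x y]
        gmul_distribs smul_add distrib_left distrib_right sgn_int_add mult.commute mult.left_commute
        add.commute add.left_commute)
    finally show ?thesis by (simp add: hp)
  qed
qed

lemma D_gvar_gmul:
  assumes "g \<in> S" "f \<in> free_gr S k"
  shows "D (gvar g \<odot> f) = \<delta> g \<odot> f + smul (sgn_int (int (gdeg g))) (gvar g \<odot> D f)"
  using assms(2)
  by (induction f rule: free_gr_induct)
    (auto simp: gmul_distribs deriv_ext_add smul_add D_gvar_gmul_single[OF assms(1)])

text \<open>The mirrored rule is needed because in the evaluations the unknown elements u, w, z of B
  stand to the left of a generator.\<close>

lemma D_gmul_gvar:
  assumes g: "g \<in> S" and f: "f \<in> free_gr S k"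
  shows "D (f \<odot> gvar g) = D f \<odot> gvar g + smul (sgn_int k) (f \<odot> \<delta> g)"
proof -
  let ?m = "int (gdeg g)"
  have x: "gvar g \<in> free_gr S ?m" and dx: "\<delta> g \<in> free_gr S (?m + 1)"
    using g by (auto intro: gvar_in_free_gr \<delta>_degree)
  show ?thesis
    by (simp add: gmul_commute[OF f x] gmul_commute[OF f dx] gmul_commute[OF D_in_free_gr[OF f] x]
      deriv_ext_smul D_gvar_gmul[OF g f] smul_add distrib_left distrib_right sgn_int_add mult_ac add_ac)
qed

lemma D_in_free_gca:
  assumes "f \<in> free_gca S"
  shows "D f \<in> free_gca S"
  using assms[unfolded free_gca_def mem_Collect_eq]
  by (induction f rule: elt_induct)
    (auto simp: deriv_ext_add intro: free_gca_add free_gr_imp_free_gca D_single_in_free_gr)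

end

section \<open>Functionals\<close>

lemma lookup_hcomp:
  "Poly_Mapping.lookup (hcomp k f) p = (if mdeg p = k then Poly_Mapping.lookup f p else 0)"
proof -
  have "Poly_Mapping.lookup (hcomp k f) p =
      (\<Sum>q\<in>{q \<in> Poly_Mapping.keys f. mdeg q = k}. if q = p then Poly_Mapping.lookup f q else 0)"
    by (simp add: hcomp_def lookup_sum lookup_single when_def)
  also have "\<dots> = (if mdeg p = k then Poly_Mapping.lookup f p else 0)"
    by (subst sum.delta) (auto simp: in_keys_iff)
  finally show ?thesis .
qed

lemma hcomp_homogeneous:
  assumes "f \<in> free_gr S j"
  shows "hcomp k f = (if k = j then f else 0)"
  using assms by (intro poly_mapping_eqI) (auto simp: lookup_hcomp free_gr_def in_keys_iff)

lemma degrees_homogeneous: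
  assumes "f \<in> free_gr S j"
  shows "degrees f = (if f = 0 then {} else {j})"
  using assms by (auto simp: degrees_def free_gr_def image_iff)
    (metis ex_in_conv keys_eq_empty)

lemma dual_add: "\<phi> \<in> dual_gr n S k \<Longrightarrow> x \<in> free_gca S \<Longrightarrow> y \<in> free_gca S \<Longrightarrow> \<phi> (x + y) = \<phi> x + \<phi> y"
  and dual_smul: "\<phi> \<in> dual_gr n S k \<Longrightarrow> x \<in> free_gca S \<Longrightarrow> \<phi> (smul c x) = c * \<phi> x"
  by (auto simp: dual_gr_def)

lemma dual_zero: "\<phi> \<in> dual_gr n S k \<Longrightarrow> \<phi> 0 = 0"
  using dual_smul[of \<phi> n S k 0 0] by simp

lemma dual_minus: "\<phi> \<in> dual_gr n S k \<Longrightarrow> x \<in> free_gca S \<Longrightarrow> \<phi> (- x) = - \<phi> x"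
  using dual_smul[of \<phi> n S k x "-1"] by (simp add: smul_minus_one)

lemma dual_minus_arg:
  "\<phi> \<in> dual_gr n S k \<Longrightarrow> x \<in> free_gca S \<Longrightarrow> y \<in> free_gca S \<Longrightarrow> \<phi> (x - y) = \<phi> x - \<phi> y"
  using dual_add[of \<phi> n S k x "- y"] dual_minus[of \<phi> n S k y] by (simp add: free_gca_uminus)

lemmas dual_linear = dual_add dual_smul dual_minus dual_minus_arg dual_zero

lemma right_act_apply: "y \<in> free_gca S \<Longrightarrow> right_act S \<phi> x y = \<phi> (x \<odot> y)"
  by (simp add: right_act_def)

lemma dual_gr_add:
  assumes "\<phi> \<in> dual_gr n S k" "\<chi> \<in> dual_gr n S k"
  shows "\<phi> + \<chi> \<in> dual_gr n S k"
  using assms by (simp add: dual_gr_def distrib_left)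

lemma right_act_in_dual_gr:
  assumes \<phi>: "\<phi> \<in> dual_gr n S k" and x: "x \<in> free_gr S i" and "l = k + i"
  shows "right_act S \<phi> x \<in> dual_gr n S l"
proof -
  have "\<phi> (x \<odot> y) = 0" if "j \<noteq> int n - l" "y \<in> free_gr S j" for j y
  proof -
    have "i + j \<noteq> int n - k" "x \<odot> y \<in> free_gr S (i + j)"
      using assms that by (auto intro: gmul_in_free_gr)
    then show ?thesis using \<phi> unfolding dual_gr_def by blast
  qed
  then show ?thesis
    using dual_linear[OF \<phi>] free_gr_imp_free_gca[OF x]
    by (auto simp: dual_gr_def right_act_def gmul_distribs free_gca_closed free_gr_imp_free_gca)
qed

lemma elt_eq_sum_hcomp: "f = (\<Sum>l\<in>degrees f. hcomp l f)"
proof (rule poly_mapping_eqI)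
  fix p
  have "(\<Sum>l\<in>degrees f. if mdeg p = l then Poly_Mapping.lookup f p else 0) = Poly_Mapping.lookup f p"
    by (subst sum.delta') (auto simp: degrees_def in_keys_iff)
  then show "Poly_Mapping.lookup f p = Poly_Mapping.lookup (\<Sum>l\<in>degrees f. hcomp l f) p"
    by (simp add: lookup_sum lookup_hcomp)
qed

lemma hcomp_in_free_gr: "f \<in> free_gca S \<Longrightarrow> hcomp l f \<in> free_gr S l"
  by (auto simp: free_gr_alt free_gca_def in_keys_iff lookup_hcomp split: if_splits)

text \<open>A functional is additive on \<open>free_gca S\<close> only, so membership of the partial
  sums is carried through the induction.\<close>

lemma dual_sum:
  assumes "\<phi> \<in> dual_gr n S m" "\<And>x. x \<in> A \<Longrightarrow> f x \<in> free_gca S"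
  shows "sum f A \<in> free_gca S \<and> \<phi> (sum f A) = (\<Sum>x\<in>A. \<phi> (f x))"
  using assms(2)
  by (induction A rule: infinite_finite_induct)
    (auto simp: dual_zero[OF assms(1)] dual_add[OF assms(1)] free_gca_add)

text \<open>A homogeneous functional sees one component of f only, so the degree-dependent sign can
  be taken out with its value there. This turns the componentwise definitions of
  \<open>dual_diff\<close> and \<open>left_act\<close> into the usual sign formulas.\<close>

lemma dual_hcomp_sum:
  assumes \<phi>: "\<phi> \<in> dual_gr n S m" and f: "f \<in> free_gca S"
  shows "(\<Sum>l\<in>degrees f. c l * \<phi> (hcomp l f)) = c (int n - m) * \<phi> f"
proof -
  have "\<phi> (hcomp l f) = 0" if "l \<noteq> int n - m" for l
    using \<phi> that hcomp_in_free_gr[OF f, of l] by (auto simp: dual_gr_def)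
  then have "(\<Sum>l\<in>degrees f. c l * \<phi> (hcomp l f)) = (\<Sum>l\<in>degrees f. c (int n - m) * \<phi> (hcomp l f))"
    by (intro sum.cong) force+
  also have "\<dots> = c (int n - m) * (\<Sum>l\<in>degrees f. \<phi> (hcomp l f))"
    by (simp add: sum_distrib_left)
  also have "(\<Sum>l\<in>degrees f. \<phi> (hcomp l f)) = \<phi> (\<Sum>l\<in>degrees f. hcomp l f)"
    using hcomp_in_free_gr[OF f]
    by (intro dual_sum[OF \<phi>, THEN conjunct2, symmetric] free_gr_imp_free_gca)
  finally show ?thesis
    by (simp flip: elt_eq_sum_hcomp)
qed

lemma left_act_apply:
  assumes "\<phi> \<in> dual_gr n S m" "x \<in> free_gr S i" "y \<in> free_gca S"
  shows "left_act n S x \<phi> y = sgn_int (i * m) * \<phi> (x \<odot> y)"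
proof (cases "x = 0")
  case False
  have "x \<odot> y \<in> free_gca S"
    using assms by (auto intro: free_gca_gmul free_gr_imp_free_gca)
  from dual_hcomp_sum[OF assms(1) this, of "\<lambda>l. sgn_int (i * (int n - l))"] False show ?thesis
    using assms by (simp add: left_act_def degrees_homogeneous hcomp_homogeneous)
qed (simp add: left_act_def degrees_def dual_zero[OF assms(1)] assms(3))

lemma left_act_zero [simp]: "left_act n S x 0 = 0"
  and right_act_zero [simp]: "right_act S 0 x = 0"
  and dual_diff_zero [simp]: "dual_diff n S \<delta> 0 = 0"
  and dual_gr_zero [simp]: "0 \<in> dual_gr n S k"
  by (auto simp: left_act_def right_act_def dual_diff_def dual_gr_def fun_eq_iff)

lemma dual_gr_scale: "\<phi> \<in> dual_gr n S k \<Longrightarrow> (\<lambda>y. c * \<phi> y) \<in> dual_gr n S k"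
  by (simp add: dual_gr_def distrib_left mult.left_commute)

lemma hat_in_dual_gr: "mdeg p = int n - k \<Longrightarrow> hat S p \<in> dual_gr n S k"
  by (auto simp: dual_gr_def hat_def lookup_add free_gca_add free_gca_smul free_gr_imp_free_gca)
    (metis (mono_tags, lifting) free_gr_def in_keys_iff mem_Collect_eq)

lemma dual_gr_eqI:
  assumes \<phi>: "\<phi> \<in> dual_gr n S k" and \<chi>: "\<chi> \<in> dual_gr n S k"
    and eq: "\<And>p c. p \<in> monomials S \<Longrightarrow> \<phi> (Poly_Mapping.single p c) = \<chi> (Poly_Mapping.single p c)"
  shows "\<phi> = \<chi>"
proof
  fix y
  show "\<phi> y = \<chi> y"
  proof (cases "y \<in> free_gca S")
    case True
    have "y \<in> free_gca S \<and> \<phi> y = \<chi> y"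
      using True[unfolded free_gca_def mem_Collect_eq]
      by (induction y rule: elt_induct)
        (auto simp: eq dual_zero[OF \<phi>] dual_zero[OF \<chi>] dual_add[OF \<phi>] dual_add[OF \<chi>]
          intro: free_gca_add single_in_free_gca)
    then show ?thesis by simp
  \<comment> \<open>Outside \<open>free_gca S\<close> both functionals are 0 by the convention in
    \<open>dual_gr\<close>.\<close>
  qed (use \<phi> \<chi> in \<open>simp add: dual_gr_def\<close>)
qed

lemma left_act_in_dual_gr:
  assumes \<phi>: "\<phi> \<in> dual_gr n S k" and x: "x \<in> free_gr S i" and "l = k + i"
  shows "left_act n S x \<phi> \<in> dual_gr n S l"
proof -
  \<comment> \<open>On homogeneous arguments the left action is a sign times the right action, whose
    degree is already known.\<close>
  have "left_act n S x \<phi> = (\<lambda>y. sgn_int (i * k) * right_act S \<phi> x y)"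
  proof
    fix y
    show "left_act n S x \<phi> y = sgn_int (i * k) * right_act S \<phi> x y"
      by (cases "y \<in> free_gca S") (simp_all add: left_act_apply[OF \<phi> x] right_act_def, simp add: left_act_def)
  qed
  then show ?thesis
    using dual_gr_scale[OF right_act_in_dual_gr[OF \<phi> x assms(3)]] by simp
qed

context graded_derivation
begin

lemma dual_diff_apply:
  assumes "\<phi> \<in> dual_gr n S m" "y \<in> free_gca S"
  shows "dual_diff n S \<delta> \<phi> y = sgn_int (m - 1) * \<phi> (D y)"
  using dual_hcomp_sum[OF assms(1) D_in_free_gca[OF assms(2)], of "\<lambda>l. sgn_int (int n - l - 1)"] assms(2)
  by (simp add: dual_diff_def)

lemma dual_diff_in_dual_gr:
  assumes \<phi>: "\<phi> \<in> dual_gr n S k" and "l = k + 1"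
  shows "dual_diff n S \<delta> \<phi> \<in> dual_gr n S l"
proof -
  have "\<phi> (D y) = 0" if "j \<noteq> int n - l" "y \<in> free_gr S j" for j y
  proof -
    have "j + 1 \<noteq> int n - k" using assms(2) that(1) by simp
    then show ?thesis using \<phi> D_in_free_gr[OF that(2)] unfolding dual_gr_def by blast
  qed
  moreover have "dual_diff n S \<delta> \<phi> y = 0" if "y \<notin> free_gca S" for y
    using that by (simp add: dual_diff_def)
  ultimately show ?thesis
    by (auto simp: dual_gr_def dual_diff_apply[OF \<phi>] deriv_ext_linear dual_add[OF \<phi>] dual_smul[OF \<phi>]
        free_gca_closed D_in_free_gca free_gr_imp_free_gca distrib_left mult.left_commute)
qed

end

section \<open>Quadruple Massey products\<close>

lemma massey_index_iff:
  "(\<forall>i j. i < j \<and> j \<le> (4::nat) \<and> (i, j) \<noteq> (0, 4) \<longrightarrow> Q i j) \<longleftrightarrow>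
    Q 0 1 \<and> Q 1 2 \<and> Q 2 3 \<and> Q 3 4 \<and> Q 0 2 \<and> Q 1 3 \<and> Q 2 4 \<and> Q 0 3 \<and> Q 1 4"
  (is "?L \<longleftrightarrow> ?R")
proof
  assume ?R
  show ?L
  proof (intro allI impI)
    fix i j :: nat assume "i < j \<and> j \<le> 4 \<and> (i, j) \<noteq> (0, 4)"
    then have "j \<in> {1, 2, 3, 4}" "i \<in> {0, 1, 2, 3}" "i < j" "(i, j) \<noteq> (0, 4)" by auto
    with \<open>?R\<close> show "Q i j" by auto
  qed
qed simp

lemma massey_index_gap_iff:
  "(\<forall>i j. i + 2 \<le> j \<and> j \<le> (4::nat) \<and> (i, j) \<noteq> (0, 4) \<longrightarrow> Q i j) \<longleftrightarrow>
    Q 0 2 \<and> Q 1 3 \<and> Q 2 4 \<and> Q 0 3 \<and> Q 1 4"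
  (is "?L \<longleftrightarrow> ?R")
proof
  assume ?R
  show ?L
  proof (intro allI impI)
    fix i j :: nat assume "i + 2 \<le> j \<and> j \<le> 4 \<and> (i, j) \<noteq> (0, 4)"
    then have "j \<in> {2, 3, 4}" "i \<in> {0, 1, 2}" "i + 2 \<le> j" "(i, j) \<noteq> (0, 4)" by auto
    with \<open>?R\<close> show "Q i j" by auto
  qed
qed simp

lemma massey_open_intervals:
  "{0<..<2} = {1::nat}" "{1<..<3} = {2::nat}" "{2<..<4} = {3::nat}"
  "{0<..<3} = {1, 2::nat}" "{1<..<4} = {2, 3::nat}" "{0<..<4} = {1, 2, 3::nat}"
  by auto

lemma massey_deg_4:
  fixes k1 k2 k3 k4 :: int and A1 A2 A3 A4 :: "'a set"
  defines "xs \<equiv> [(k1, A1), (k2, A2), (k3, A3), (k4, A4)]"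
  shows "massey_deg xs 0 1 = k1" "massey_deg xs 1 2 = k2" "massey_deg xs 2 3 = k3"
    "massey_deg xs 3 4 = k4" "massey_deg xs 0 2 = k1 + k2 - 1" "massey_deg xs 1 3 = k2 + k3 - 1"
    "massey_deg xs 2 4 = k3 + k4 - 1" "massey_deg xs 0 3 = k1 + k2 + k3 - 2"
    "massey_deg xs 1 4 = k2 + k3 + k4 - 2" "massey_deg xs 0 4 = k1 + k2 + k3 + k4 - 3"
  by (simp_all add: massey_deg_def xs_def eval_nat_numeral)

text \<open>The simplifier rewrites the index \<open>1\<close> to \<open>Suc 0\<close>, so the
  degrees are kept in both forms.\<close>

lemmas massey_deg_4_Suc = massey_deg_4[unfolded One_nat_def]

lemma defining_system_4:
  "defining_system C [(k1, A1), (k2, A2), (k3, A3), (k4, A4)] a \<longleftrightarrow>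
    (a 0 1 \<in> gr C k1 \<and> a 1 2 \<in> gr C k2 \<and> a 2 3 \<in> gr C k3 \<and> a 3 4 \<in> gr C k4 \<and>
     a 0 2 \<in> gr C (k1 + k2 - 1) \<and> a 1 3 \<in> gr C (k2 + k3 - 1) \<and> a 2 4 \<in> gr C (k3 + k4 - 1) \<and>
     a 0 3 \<in> gr C (k1 + k2 + k3 - 2) \<and> a 1 4 \<in> gr C (k2 + k3 + k4 - 2)) \<and>
    (diff C (a 0 1) = 0 \<and> a 0 1 \<in> A1 \<and> diff C (a 1 2) = 0 \<and> a 1 2 \<in> A2 \<and>
     diff C (a 2 3) = 0 \<and> a 2 3 \<in> A3 \<and> diff C (a 3 4) = 0 \<and> a 3 4 \<in> A4) \<and>
    (diff C (a 0 2) = mul C (bar k1 (a 0 1)) (a 1 2) \<and>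
     diff C (a 1 3) = mul C (bar k2 (a 1 2)) (a 2 3) \<and>
     diff C (a 2 4) = mul C (bar k3 (a 2 3)) (a 3 4) \<and>
     diff C (a 0 3) = mul C (bar k1 (a 0 1)) (a 1 3) + mul C (bar (k1 + k2 - 1) (a 0 2)) (a 2 3) \<and>
     diff C (a 1 4) = mul C (bar k2 (a 1 2)) (a 2 4) + mul C (bar (k2 + k3 - 1) (a 1 3)) (a 3 4))"
proof -
  have len: "length [(k1, A1), (k2, A2), (k3, A3), (k4, A4)] = 4" by simp
  have all: "(\<forall>i<4. Q i) \<longleftrightarrow> Q 0 \<and> Q 1 \<and> Q 2 \<and> Q 3" for Q :: "nat \<Rightarrow> bool"
    by (auto simp: eval_nat_numeral less_Suc_eq)
  have Suc: "Suc 1 = 2" "Suc 2 = 3" "Suc 3 = 4" "Suc 0 = 1" by auto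
  show ?thesis
    unfolding defining_system_def len massey_index_iff massey_index_gap_iff massey_open_intervals all
      massey_deg_4 Suc
    by (simp add: massey_deg_4_Suc)
qed

lemma massey_value_4:
  "massey_value C [(k1, A1), (k2, A2), (k3, A3), (k4, A4)] a =
    mul C (bar k1 (a 0 1)) (a 1 4) + mul C (bar (k1 + k2 - 1) (a 0 2)) (a 2 4)
      + mul C (bar (k1 + k2 + k3 - 2) (a 0 3)) (a 3 4)"
proof -
  have len: "length [(k1, A1), (k2, A2), (k3, A3), (k4, A4)] = 4" by simp
  show ?thesis
    unfolding massey_value_def len massey_open_intervals
    by (simp add: massey_deg_4 massey_deg_4_Suc add.assoc)
qed

section \<open>The algebra B\<close>

lemma triple_mset_neq_pair: "{#a, b, c#} \<noteq> {#d, e#}"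
  by (metis size_add_mset size_empty Suc_inject nat.distinct(1))

lemma pair_mset_eq: "{#a, b#} = {#c, d#} \<longleftrightarrow> a = c \<and> b = d \<or> a = d \<and> b = c"
  by (auto simp: add_eq_conv_diff)

lemma monomials_mono: "S \<subseteq> T \<Longrightarrow> monomials S \<subseteq> monomials T"
  by (auto simp: monomials_def)

lemma free_gr_mono: "S \<subseteq> T \<Longrightarrow> free_gr S k \<subseteq> free_gr T k"
  using monomials_mono[of S T] by (auto simp: free_gr_alt)

lemma free_dga_simps [simp]:
  "gr (free_dga T \<delta>) = free_gr T" "scal (free_dga T \<delta>) = smul" "diff (free_dga T \<delta>) = deriv_ext \<delta>"
  by (simp_all add: free_dga_def)

lemma coh_class_free_dga_self: "x \<in> coh_class (free_dga T \<delta>) k x"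
  by (auto simp: coh_class_def intro: exI[of _ 0])

lemma coh_class_free_dga_eq:
  assumes "y \<in> free_gr T (k - 1)" "x' = x + deriv_ext \<delta> y"
  shows "coh_class (free_dga T \<delta>) k x' = coh_class (free_dga T \<delta>) k x"
proof -
  have "x + deriv_ext \<delta> z \<in> coh_class (free_dga T \<delta>) k x'" if "z \<in> free_gr T (k - 1)" for z
    using assms that
    by (auto simp: coh_class_def deriv_ext_linear intro!: exI[of _ "z - y"] free_gr_diff)
  moreover have "x' + deriv_ext \<delta> z \<in> coh_class (free_dga T \<delta>) k x" if "z \<in> free_gr T (k - 1)" for z
    using assms that
    by (auto simp: coh_class_def deriv_ext_linear intro!: exI[of _ "y + z"] free_gr_add)
  ultimately show ?thesis
    by (auto simp: coh_class_def)
qed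

section \<open>Generators and stages of B\<close>

locale B_algebra =
  fixes I J :: "nat \<Rightarrow> nat set"
    and zV zW :: "nat \<Rightarrow> nat \<Rightarrow> gen elt"
  assumes construction: "B_construction I zV J zW"
begin

abbreviation S :: "gen set" where "S \<equiv> B_gens I J"
abbreviation \<delta> :: "gen \<Rightarrow> gen elt" where "\<delta> \<equiv> d_gen zV zW"

lemma basic_gens [simp]:
  "GX \<in> S" "GY \<in> S" "Ga \<in> S" "Gb \<in> S" "Gc \<in> S" "Ge \<in> S" "Gf \<in> S" "Gh \<in> S" "Gi \<in> S"
  "Galpha \<in> S" "Ggamma \<in> S" "SXalpha \<in> S" "SYalpha \<in> S" "SXgamma \<in> S" "SYgamma \<in> S"
  "T1 \<in> S" "T2 \<in> S" "T3 \<in> S" "T4 \<in> S" "T5 \<in> S" "T6 \<in> S" "T7 \<in> S" "T8 \<in> S" "T9 \<in> S"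
  by (auto simp: B_gens_def V_gens_def W_gens_def)

definition stage :: "nat \<Rightarrow> gen set" where
  "stage k = V_gens I \<union> {g \<in> W_gens J. gdeg g < k}"

lemma stage_subset: "stage k \<subseteq> S"
  by (auto simp: stage_def B_gens_def)

lemma stage_basis: "k \<ge> 6 \<Longrightarrow> represents_basis (free_dga (stage k) \<delta>) (int k + 1) (J k) (zW k)"
  using construction by (simp add: B_construction_def stage_def)

text \<open>Separates the generators whose differential is a chosen cocycle, with its degree
  supplied by the construction, from those whose differential is explicit.\<close>

lemma gens_cases:
  assumes "g \<in> S"
  obtains (V) k i where "g = NewV k i" "k \<ge> 6" "i \<in> I k"
    | (W) k i where "g = NewW k i" "k \<ge> 6" "i \<in> J k"
    | (basic) "\<And>k i. g \<noteq> NewV k i" "\<And>k i. g \<noteq> NewW k i"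
  using assms by (cases g) (auto simp: B_gens_def V_gens_def W_gens_def)

lemma zV_in_free_gr:
  assumes "k \<ge> 6" "i \<in> I k"
  shows "zV k i \<in> free_gr S (int k + 1)"
proof -
  let ?T = "{g \<in> V_gens I. gdeg g < k}"
  have "zV k i \<in> cocycles (free_dga ?T \<delta>) (int k + 1)"
    using construction assms
    by (simp add: B_construction_def A_construction_def represents_basis_def)
  then have "zV k i \<in> free_gr ?T (int k + 1)"
    by (simp add: cocycles_def)
  then show ?thesis
    using free_gr_mono[of ?T S] by (auto simp: B_gens_def)
qed

lemma zW_in_free_gr:
  assumes "k \<ge> 6" "i \<in> J k"
  shows "zW k i \<in> free_gr (stage k) (int k + 1)"
  using stage_basis[OF assms(1)] assms(2)
  by (simp add: represents_basis_def cocycles_def)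

lemma gmul_gvar_in_free_gr:
  "g \<in> S \<Longrightarrow> h \<in> S \<Longrightarrow> k = int (gdeg g) + int (gdeg h) \<Longrightarrow> gvar g \<odot> gvar h \<in> free_gr S k"
  by (auto intro: gmul_in_free_gr gvar_in_free_gr)

lemma gen_m_in_free_gr: "gen_m \<in> free_gr S 6"
  unfolding gen_m_def by (auto intro!: free_gr_add gmul_gvar_in_free_gr)

sublocale graded_derivation S \<delta>
proof
  fix g assume g: "g \<in> S"
  show "\<delta> g \<in> free_gr S (int (gdeg g) + 1)"
    using g
  proof (cases rule: gens_cases)
    case V
    then show ?thesis using zV_in_free_gr by simp
  next
    case W
    then show ?thesis
      using subsetD[OF free_gr_mono[OF stage_subset] zW_in_free_gr] by simp
  next
    case basic
    then show ?thesis
      using g gen_m_in_free_gr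
      by (cases g) (auto intro!: free_gr_add free_gr_diff gmul_gvar_in_free_gr)
  qed
qed

section \<open>Low-degree monomials and exactness in degrees at least 7\<close>

lemma gdeg_ge_2: "g \<in> S \<Longrightarrow> gdeg g \<ge> 2"
  by (cases g) (auto simp: B_gens_def V_gens_def W_gens_def)

lemma gdeg_2: "g \<in> S \<Longrightarrow> gdeg g = 2 \<Longrightarrow> g \<in> {GX, GY}"
  and gdeg_3: "g \<in> S \<Longrightarrow> gdeg g = 3 \<Longrightarrow> g \<in> {Ga, Gb, Gc, Galpha, Ggamma}"
  and gdeg_4: "g \<in> S \<Longrightarrow> gdeg g = 4 \<Longrightarrow> g \<in> {Ge, Gf, SXalpha, SYalpha, SXgamma, SYgamma}"
  and gdeg_5: "g \<in> S \<Longrightarrow> gdeg g = 5 \<Longrightarrow> g \<in> {Gh, Gi, T1, T2, T3, T4, T5, T6, T7, T8, T9}"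
  by (cases g; auto simp: B_gens_def V_gens_def W_gens_def)+

lemma mdeg_ge:
  assumes "p \<in> monomials S"
  shows "mdeg p \<ge> 2 * int (size p)"
  using assms
proof (induction p)
  case (add g p)
  have "p \<in> monomials S" "g \<in> S"
    using add.prems monomials_subset[OF add.prems, of p] by (auto simp: monomials_def)
  then show ?case
    using add.IH gdeg_ge_2[of g] by simp
qed simp

text \<open>All generators have degree at least 2, which leaves room for at most two factors; if
  there are two, they cannot both have degree at least 3.\<close>

lemma low_degree_cases:
  assumes "p \<in> monomials S" "mdeg p < 6"
  obtains (empty) "p = {#}"
    | (gen) g where "p = {#g#}" "g \<in> S" "mdeg p = int (gdeg g)"
    | (prod) g h where "p = {#g, h#}" "g \<in> S" "h \<in> S" "gdeg g = 2" "mdeg p = 2 + int (gdeg h)"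
        "gdeg h = 2 \<or> gdeg h = 3"
proof -
  have S: "g \<in> S" if "g \<in># p" for g
    using assms(1) that by (auto simp: monomials_def)
  have "size p = 0 \<or> size p = 1 \<or> size p = 2"
    using mdeg_ge[OF assms(1)] assms(2) by linarith
  then show thesis
  proof (elim disjE)
    assume "size p = 1"
    then obtain g where "p = {#g#}" by (metis size_1_singleton_mset)
    then show thesis using S by (auto intro: gen)
  next
    assume "size p = 2"
    then obtain g h where p: "p = {#g, h#}"
      by (metis One_nat_def Suc_1 size_1_singleton_mset size_eq_Suc_imp_eq_union add_mset_add_single
          diff_single_trivial multi_self_add_other_not_self numeral_2_eq_2 size_mset_SucE)
    have gh: "g \<in> S" "h \<in> S" using S p by auto
    have sum: "gdeg g + gdeg h < 6" using assms(2) p by simp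
    show thesis
    proof (cases "gdeg g = 2")
      case True
      then show ?thesis
        using gh sum p gdeg_ge_2[of h] by (intro prod[of g h]) auto
    next
      case False
      then show ?thesis
        using gh sum p gdeg_ge_2[of g] gdeg_ge_2[of h]
        by (intro prod[of h g]) (auto simp: add_mset_commute)
    qed
  qed (auto intro: empty)
qed

text \<open>A factor outside stage k - 1 is a W generator of degree at least k - 1, so at most
  degree 1 is left for the other factors and there are none. Stage k - 1 is the right one because
  its cohomology in degree k is what the generators \<open>NewW (k - 1) i\<close> kill.\<close>

lemma top_degree_cases:
  assumes p: "p \<in> monomials S" and "mdeg p = int k" "k \<ge> 7"
  shows "p \<in> monomials (stage (k - 1)) \<or> (\<exists>i\<in>J k. p = {#NewW k i#})"
proof (cases "p \<in> monomials (stage (k - 1))")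
  case False
  then obtain g where g: "g \<in># p" "g \<notin> stage (k - 1)"
    using p by (auto simp: monomials_def)
  then obtain q where q: "p = add_mset g q"
    by (meson mset_add)
  have "g \<in> S" using p g(1) by (auto simp: monomials_def)
  then have W: "g \<in> W_gens J" "gdeg g \<ge> k - 1"
    using g(2) by (auto simp: stage_def B_gens_def)
  have "q \<in> monomials S"
    using p monomials_subset[of p S q] q by simp
  moreover have "mdeg q \<le> 1"
    using W(2) assms(2,3) q by simp
  ultimately have "q = {#}"
    using mdeg_ge[of q] by (cases "size q") auto
  then show ?thesis
    using W(1) assms(2,3) q by (auto simp: W_gens_def)
qed simp

text \<open>No generator has degree \<open>1\<close>, so a cocycle of degree \<open>k\<close> consists of a part from stage \<open>k - 1\<close>
  and a linear combination of generators \<open>NewW k i\<close>, whose coefficients vanish because the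
  cocycles \<open>zW k i\<close> are independent in the cohomology of stage \<open>k\<close>.\<close>

lemma cocycle_in_stage:
  assumes x: "x \<in> free_gr S (int k)" and "D x = 0" and "k \<ge> 7"
  shows "x \<in> free_gr (stage (k - 1)) (int k)"
proof -
  define F where "F = {i. {#NewW k i#} \<in> Poly_Mapping.keys x}"
  define c where "c i = Poly_Mapping.lookup x {#NewW k i#}" for i
  define x2 where "x2 = (\<Sum>i\<in>F. smul (c i) (gvar (NewW k i)))"
  have "inj_on (\<lambda>i. {#NewW k i#}) F" by (auto simp: inj_on_def)
  moreover have "finite ((\<lambda>i. {#NewW k i#}) ` F)"
    by (rule finite_subset[OF _ finite_keys[of x]]) (auto simp: F_def)
  ultimately have F: "finite F" using finite_imageD by blast
  have keys: "p \<in> monomials S" "mdeg p = int k" if "p \<in> Poly_Mapping.keys x" for p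
    using x that by (auto simp: free_gr_alt)
  have FJ: "F \<subseteq> J k"
  proof
    fix i assume "i \<in> F"
    then have "{#NewW k i#} \<in> monomials S" by (intro keys) (simp add: F_def)
    then have "NewW k i \<in> S" by simp
    then show "i \<in> J k" by (auto simp: B_gens_def V_gens_def W_gens_def)
  qed
  have lookup2: "Poly_Mapping.lookup x2 p =
      (if \<exists>i\<in>F. p = {#NewW k i#} then Poly_Mapping.lookup x p else 0)" for p
  proof -
    have "Poly_Mapping.lookup x2 p = (\<Sum>i\<in>F. if p = {#NewW k i#} then c i else 0)"
      unfolding x2_def by (auto simp: lookup_sum gvar_def lookup_single when_def intro!: sum.cong)
    also have "\<dots> = (if \<exists>i\<in>F. p = {#NewW k i#} then Poly_Mapping.lookup x p else 0)"
    proof (cases "\<exists>i\<in>F. p = {#NewW k i#}")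
      case True
      then obtain i where i: "i \<in> F" "p = {#NewW k i#}" by blast
      have "(\<Sum>i\<in>F. if p = {#NewW k i#} then c i else 0) = (\<Sum>j\<in>F. if j = i then c i else 0)"
        using i by (intro sum.cong) auto
      then show ?thesis using i F by (auto simp: c_def)
    qed (auto intro: sum.neutral)
    finally show ?thesis .
  qed
  have x1: "x - x2 \<in> free_gr (stage (k - 1)) (int k)"
    unfolding free_gr_alt
  proof safe
    fix p assume "p \<in> Poly_Mapping.keys (x - x2)"
    then have "Poly_Mapping.lookup x p \<noteq> 0" "\<not> (\<exists>i\<in>F. p = {#NewW k i#})"
      by (auto simp: in_keys_iff lookup_minus lookup2 split: if_splits)
    then have p: "p \<in> Poly_Mapping.keys x" "\<forall>i. p \<noteq> {#NewW k i#}"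
      by (auto simp: F_def in_keys_iff)
    then show "p \<in> monomials (stage (k - 1))" "mdeg p = int k"
      using top_degree_cases[OF keys[OF p(1)] \<open>k \<ge> 7\<close>] keys[OF p(1)] by auto
  qed
  have Dx2: "D x2 = (\<Sum>i\<in>F. smul (c i) (zW k i))"
    unfolding x2_def by (simp add: deriv_ext_sum deriv_ext_smul)
  \<comment> \<open>Since D x = 0, the combination D x2 of the \<open>zW k i\<close> is the boundary
    of -(x - x2), an element of a smaller stage.\<close>
  have "(\<Sum>i\<in>F. smul (c i) (zW k i)) = 0 + D (- (x - x2))"
    using \<open>D x = 0\<close> by (simp add: deriv_ext_linear flip: Dx2)
  moreover have "stage (k - 1) \<subseteq> stage k"
    by (auto simp: stage_def)
  then have "- (x - x2) \<in> free_gr (stage k) (int k + 1 - 1)"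
    using subsetD[OF free_gr_mono x1] by (intro free_gr_uminus) simp
  ultimately have "coh_class (free_dga (stage k) \<delta>) (int k + 1) (\<Sum>i\<in>F. smul (c i) (zW k i)) =
      coh_class (free_dga (stage k) \<delta>) (int k + 1) 0"
    by (intro coh_class_free_dga_eq)
  then have "\<forall>i\<in>F. c i = 0"
    using stage_basis[of k] F FJ \<open>k \<ge> 7\<close> by (simp add: represents_basis_def)
  then have "F = {}" by (auto simp: F_def c_def in_keys_iff)
  then show ?thesis using x1 by (simp add: x2_def)
qed

text \<open>For m = k - 1, the cocycle x lies in stage m, where it is a combination of the
  \<open>zW m i\<close> up to a boundary; in B each \<open>zW m i\<close> is the boundary of
  \<open>NewW m i\<close>.\<close>

lemma exact_ge_7:
  assumes x: "x \<in> free_gr S k" and "D x = 0" and "k \<ge> 7"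
  obtains y where "y \<in> free_gr S (k - 1)" "D y = x"
proof -
  define m where "m = nat k - 1"
  have m: "k = int (Suc m)" "m \<ge> 6" using \<open>k \<ge> 7\<close> by (auto simp: m_def)
  have "x \<in> free_gr (stage m) (int m + 1)"
    using cocycle_in_stage[of x "Suc m"] assms m by (simp add: add.commute)
  then have cocycle: "x \<in> cocycles (free_dga (stage m) \<delta>) (int m + 1)"
    using \<open>D x = 0\<close> by (simp add: cocycles_def)
  have "\<forall>x\<in>cocycles (free_dga (stage m) \<delta>) (int m + 1). \<exists>F c. finite F \<and> F \<subseteq> J m \<and>
      coh_class (free_dga (stage m) \<delta>) (int m + 1) x =
      coh_class (free_dga (stage m) \<delta>) (int m + 1) (\<Sum>i\<in>F. smul (c i) (zW m i))"
    using stage_basis[OF m(2)] unfolding represents_basis_def free_dga_simps by (elim conjE)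
  from bspec[OF this cocycle] obtain F c where F: "finite F" "F \<subseteq> J m"
    and eq: "coh_class (free_dga (stage m) \<delta>) (int m + 1) x =
      coh_class (free_dga (stage m) \<delta>) (int m + 1) (\<Sum>i\<in>F. smul (c i) (zW m i))"
    by blast
  then have "x \<in> coh_class (free_dga (stage m) \<delta>) (int m + 1) (\<Sum>i\<in>F. smul (c i) (zW m i))"
    using coh_class_free_dga_self by blast
  then obtain y where y: "y \<in> free_gr (stage m) (int m)"
    "x = (\<Sum>i\<in>F. smul (c i) (zW m i)) + D y"
    by (auto simp: coh_class_def)
  let ?w = "(\<Sum>i\<in>F. smul (c i) (gvar (NewW m i)))"
  have "NewW m i \<in> S" if "i \<in> F" for i
    using F that m by (auto simp: B_gens_def W_gens_def)
  then have "?w + y \<in> free_gr S (k - 1)"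
    using y(1) free_gr_mono[OF stage_subset] m
    by (auto intro!: free_gr_add free_gr_sum free_gr_smul gvar_in_free_gr)
  moreover have "D (?w + y) = x"
    by (simp add: y(2) deriv_ext_linear deriv_ext_sum)
  ultimately show thesis by (rule that)
qed

section \<open>Explicit computations in degrees 3 and 4\<close>

lemma monomials_degree_3:
  assumes "p \<in> monomials S" "mdeg p = 3"
  shows "p \<in> {{#Ga#}, {#Gb#}, {#Gc#}, {#Galpha#}, {#Ggamma#}}"
proof -
  have "mdeg p < 6" using assms(2) by simp
  with assms(1) show ?thesis
  proof (cases rule: low_degree_cases)
    case (gen g)
    then show ?thesis using assms(2) gdeg_3[of g] by auto
  qed (use assms(2) in auto)
qed

lemma monomials_degree_4:
  assumes "p \<in> monomials S" "mdeg p = 4"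
  shows "p \<in> {{#GX, GX#}, {#GX, GY#}, {#GY, GY#},
    {#Ge#}, {#Gf#}, {#SXalpha#}, {#SYalpha#}, {#SXgamma#}, {#SYgamma#}}"
proof -
  have "mdeg p < 6" using assms(2) by simp
  with assms(1) show ?thesis
  proof (cases rule: low_degree_cases)
    case (gen g)
    then show ?thesis using assms(2) gdeg_4[of g] by auto
  next
    case (prod g h)
    then show ?thesis using assms(2) gdeg_2[of g] gdeg_2[of h] by (auto simp: add_mset_commute)
  qed (use assms(2) in auto)
qed

lemma degree_3_expansion:
  assumes "f \<in> free_gr S 3"
  obtains c1 c2 c3 c4 c5 where
    "f = smul c1 (gvar Ga) + smul c2 (gvar Gb) + smul c3 (gvar Gc)
      + smul c4 (gvar Galpha) + smul c5 (gvar Ggamma)"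
proof -
  let ?A = "{{#Ga#}, {#Gb#}, {#Gc#}, {#Galpha#}, {#Ggamma#}}"
  have "Poly_Mapping.keys f \<subseteq> ?A"
    using assms monomials_degree_3 unfolding free_gr_alt by blast
  then have "f = (\<Sum>p\<in>?A. Poly_Mapping.single p (Poly_Mapping.lookup f p))"
    by (intro elt_as_sum) auto
  then show thesis
    by (intro that) (simp add: gvar_def add.assoc)
qed

lemma degree_4_expansion:
  assumes "f \<in> free_gr S 4"
  obtains c1 c2 c3 c4 c5 c6 c7 c8 c9 where
    "f = smul c1 (gvar GX \<odot> gvar GX) + smul c2 (gvar GX \<odot> gvar GY) + smul c3 (gvar GY \<odot> gvar GY)
      + smul c4 (gvar Ge) + smul c5 (gvar Gf) + smul c6 (gvar SXalpha) + smul c7 (gvar SYalpha)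
      + smul c8 (gvar SXgamma) + smul c9 (gvar SYgamma)"
proof -
  let ?A = "{{#GX, GX#}, {#GX, GY#}, {#GY, GY#},
    {#Ge#}, {#Gf#}, {#SXalpha#}, {#SYalpha#}, {#SXgamma#}, {#SYgamma#}}"
  have "Poly_Mapping.keys f \<subseteq> ?A"
    using assms monomials_degree_4 unfolding free_gr_alt by blast
  then have "f = (\<Sum>p\<in>?A. Poly_Mapping.single p (Poly_Mapping.lookup f p))"
    by (intro elt_as_sum) auto
  then show thesis
    by (intro that) (simp add: gvar_def pair_mset_eq add.assoc add_mset_commute)
qed

lemma D_quadratic [simp]:
  "D (gvar GX \<odot> gvar GX) = 0" "D (gvar GX \<odot> gvar GY) = 0" "D (gvar GY \<odot> gvar GY) = 0"
  by (simp_all add: D_gvar_gmul[OF _ gvar_in_free_gr])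

text \<open>a, b, c have linearly independent boundaries, while \<alpha> and \<gamma> are closed.
  This is the whole indeterminacy of the part of \<open>a 0 2\<close> in B;
  \<open>primitive_YY\<close> plays the same role for \<open>a 1 3\<close>.\<close>

lemma primitive_XY:
  assumes "f \<in> free_gr S 3" "D f = - (gvar GX \<odot> gvar GY)"
  obtains p q where "f = smul p (gvar Galpha) + smul q (gvar Ggamma) - gvar Gb"
  using assms(1)
proof (cases rule: degree_3_expansion)
  case (1 c1 c2 c3 c4 c5)
  have "D f = smul c1 (gvar GX \<odot> gvar GX) + smul c2 (gvar GX \<odot> gvar GY) + smul c3 (gvar GY \<odot> gvar GY)"
    by (simp add: 1 deriv_ext_linear)
  then have "Poly_Mapping.lookup (D f) {#GX, GX#} = c1" "Poly_Mapping.lookup (D f) {#GX, GY#} = c2"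
    "Poly_Mapping.lookup (D f) {#GY, GY#} = c3"
    by (simp_all add: gvar_def lookup_add lookup_single pair_mset_eq)
  then have "c1 = 0" "c2 = - 1" "c3 = 0"
    by (simp_all add: assms(2) gvar_def lookup_single pair_mset_eq)
  then show thesis
    using that[of c4 c5] by (simp add: 1 smul_minus_one)
qed

lemma primitive_YY:
  assumes "f \<in> free_gr S 3" "D f = - (gvar GY \<odot> gvar GY)"
  obtains p q where "f = smul p (gvar Galpha) + smul q (gvar Ggamma) - gvar Gc"
  using assms(1)
proof (cases rule: degree_3_expansion)
  case (1 c1 c2 c3 c4 c5)
  have "D f = smul c1 (gvar GX \<odot> gvar GX) + smul c2 (gvar GX \<odot> gvar GY) + smul c3 (gvar GY \<odot> gvar GY)"
    by (simp add: 1 deriv_ext_linear)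
  then have "Poly_Mapping.lookup (D f) {#GX, GX#} = c1" "Poly_Mapping.lookup (D f) {#GX, GY#} = c2"
    "Poly_Mapping.lookup (D f) {#GY, GY#} = c3"
    by (simp_all add: gvar_def lookup_add lookup_single pair_mset_eq)
  then have "c1 = 0" "c2 = 0" "c3 = - 1"
    by (simp_all add: assms(2) gvar_def lookup_single pair_mset_eq)
  then show thesis
    using that[of c4 c5] by (simp add: 1 smul_minus_one)
qed

text \<open>Each of the six monomials whose coefficients are read off occurs in the boundary of
  exactly one generator of degree 4, so all six generators must be absent. This bounds the
  indeterminacy of \<open>a 0 3\<close>.\<close>

lemma cocycle_degree_4:
  assumes "f \<in> free_gr S 4" "D f = 0"
  obtains c1 c2 c3 where
    "f = smul c1 (gvar GX \<odot> gvar GX) + smul c2 (gvar GX \<odot> gvar GY) + smul c3 (gvar GY \<odot> gvar GY)"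
  using assms(1)
proof (cases rule: degree_4_expansion)
  case (1 c1 c2 c3 c4 c5 c6 c7 c8 c9)
  have "D f = smul c4 (\<delta> Ge) + smul c5 (\<delta> Gf) + smul c6 (\<delta> SXalpha) + smul c7 (\<delta> SYalpha)
      + smul c8 (\<delta> SXgamma) + smul c9 (\<delta> SYgamma)"
    by (simp add: 1 deriv_ext_linear del: d_gen.simps)
  then have "Poly_Mapping.lookup (D f) {#GY, Ga#} = c4" "Poly_Mapping.lookup (D f) {#GY, Gb#} = c5"
    "Poly_Mapping.lookup (D f) {#GX, Galpha#} = c6" "Poly_Mapping.lookup (D f) {#GY, Galpha#} = c7"
    "Poly_Mapping.lookup (D f) {#GX, Ggamma#} = c8" "Poly_Mapping.lookup (D f) {#GY, Ggamma#} = c9"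
    by (simp_all add: gvar_def lookup_add lookup_minus lookup_single pair_mset_eq)
  then have "c4 = 0" "c5 = 0" "c6 = 0" "c7 = 0" "c8 = 0" "c9 = 0"
    by (simp_all add: assms(2))
  then show thesis
    using that[of c1 c2 c3] by (simp add: 1)
qed

section \<open>Evaluation of the product at X\<close>

lemma gvar_odd_anticommute:
  assumes "g \<in> S" "h \<in> S" "odd (gdeg g)" "odd (gdeg h)"
  shows "gvar g \<odot> gvar h = - (gvar h \<odot> gvar g)"
  using gmul_commute[OF gvar_in_free_gr[OF assms(1) refl] gvar_in_free_gr[OF assms(2) refl]] assms(3,4)
  by (simp add: sgn_int_def smul_minus_one)

lemma gvar_odd_square: "odd (gdeg g) \<Longrightarrow> gvar g \<odot> gvar g = 0"
  by (simp add: gvar_def koszul_def)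

lemma gvar_even_commute:
  assumes "g \<in> S" "even (gdeg g)" "f \<in> free_gr S k"
  shows "f \<odot> gvar g = gvar g \<odot> f"
  using assms by (intro gmul_commute_even[OF _ gvar_in_free_gr]) auto

text \<open>The functionals \<open>\<psi>\<close> and \<open>\<theta>\<close> are the dual parts of the entries \<open>a\<^sub>2\<^sub>4\<close> and \<open>a\<^sub>1\<^sub>4\<close> after a change
  of the defining system that removes their parts in \<open>B\<close>.\<close>

lemma value_at_X_reduced:
  fixes \<Phi> \<psi> \<theta> :: "gen elt \<Rightarrow> rat" and \<sigma> :: rat
  assumes \<sigma>: "\<sigma> * \<sigma> = 1"
    and \<Phi>: "\<Phi> \<in> dual_gr n S k" and \<psi>: "\<psi> \<in> dual_gr n S l" and \<theta>: "\<theta> \<in> dual_gr n S m"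
    and s: "s \<in> free_gr S 3" "D s = - (gvar GX \<odot> gvar GY)"
    and t: "t \<in> free_gr S 3" "D t = - (gvar GY \<odot> gvar GY)"
    and r: "r \<in> free_gr S 4" "D r = s \<odot> gvar GY - gvar GX \<odot> t"
    and d\<Phi>: "\<And>v. v \<in> free_gr S 5 \<Longrightarrow> \<Phi> (D v) = 0"
    and d\<psi>: "\<And>g. g \<in> S \<Longrightarrow> gdeg g = 4 \<Longrightarrow> \<sigma> * \<psi> (\<delta> g) = - \<Phi> (gvar GY \<odot> gvar g)"
    and d\<theta>: "\<And>g. g \<in> S \<Longrightarrow> gdeg g = 3 \<Longrightarrow>
      - \<sigma> * \<theta> (\<delta> g) = - \<psi> (gvar GY \<odot> gvar g) + \<sigma> * \<Phi> (t \<odot> gvar g)"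
    and \<alpha>\<gamma>: "\<Phi> (gvar Galpha \<odot> gvar Ggamma) = 1"
  shows "- \<theta> (gvar GX \<odot> gvar GX) - \<sigma> * \<psi> (s \<odot> gvar GX) - \<Phi> (r \<odot> gvar GX) = 1"
proof -
  note lin = dual_linear[OF \<Phi>] dual_linear[OF \<psi>] dual_linear[OF \<theta>] gmul_distribs free_gca_closed
  obtain p q where s_eq: "s = smul p (gvar Galpha) + smul q (gvar Ggamma) - gvar Gb"
    using primitive_XY[OF s] by blast
  obtain p' q' where t_eq: "t = smul p' (gvar Galpha) + smul q' (gvar Ggamma) - gvar Gc"
    using primitive_YY[OF t] by blast
  have gens: "\<Phi> (\<delta> g) = 0" if "g \<in> S" "gdeg g = 5" for g
    using d\<Phi>[of "gvar g"] that by (simp add: gvar_in_free_gr)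
  have 1: "\<Phi> (gvar GY \<odot> gvar Ge) + \<Phi> (gvar Ga \<odot> gvar Gc) + \<Phi> (gvar GX \<odot> gvar Gf) = 1"
    using gens[of T1] \<alpha>\<gamma> by (simp add: lin gen_m_def)
  have 2: "\<Phi> (gvar GY \<odot> gvar SXalpha) = \<Phi> (gvar GX \<odot> gvar SYalpha)"
    and 3: "\<Phi> (gvar GY \<odot> gvar SXgamma) = \<Phi> (gvar GX \<odot> gvar SYgamma)"
    and 6: "\<Phi> (gvar Gc \<odot> gvar Galpha) = \<Phi> (gvar GY \<odot> gvar SYalpha)"
    and 9: "\<Phi> (gvar Gc \<odot> gvar Ggamma) = \<Phi> (gvar GY \<odot> gvar SYgamma)"
    using gens[of T2] gens[of T3] gens[of T6] gens[of T9] by (simp_all add: lin)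
  note \<psi>e = d\<psi>[of Ge, simplified] and \<psi>s = d\<psi>[of SXalpha, simplified] d\<psi>[of SYalpha, simplified]
    d\<psi>[of SXgamma, simplified] d\<psi>[of SYgamma, simplified]
  \<comment> \<open>\<alpha> and \<gamma> are closed, so the left side of the equation for \<theta>
    vanishes on them.\<close>
  have \<psi>Y: "\<psi> (gvar GY \<odot> gvar g) = \<sigma> * \<Phi> (t \<odot> gvar g)" if "g = Galpha \<or> g = Ggamma" for g
    using d\<theta>[of g] that by (auto simp: dual_zero[OF \<theta>])
  have sq: "\<sigma> * (\<sigma> * c) = c" for c
    using \<sigma> by (simp flip: mult.assoc)
  \<comment> \<open>Two computations of \<Phi>(t \<alpha>): through \<psi>, the generator
    \<open>SYalpha\<close> and v_6, and by expanding t. They differ by q' \<Phi>(\<gamma>\<alpha>) =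
    - q'. The same with \<gamma> in place of \<alpha> isolates p'.\<close>
  have "\<Phi> (t \<odot> gvar Galpha) = - \<Phi> (gvar Gc \<odot> gvar Galpha)"
    using \<psi>s(2) \<psi>Y[of Galpha] 6 by (simp add: sq)
  moreover have "\<Phi> (t \<odot> gvar Galpha) = - q' - \<Phi> (gvar Gc \<odot> gvar Galpha)"
    using \<alpha>\<gamma> by (simp add: t_eq lin gvar_odd_square gvar_odd_anticommute[of Ggamma Galpha])
  ultimately have q': "q' = 0" by simp
  have "\<Phi> (t \<odot> gvar Ggamma) = - \<Phi> (gvar Gc \<odot> gvar Ggamma)"
    using \<psi>s(4) \<psi>Y[of Ggamma] 9 by (simp add: sq)
  moreover have "\<Phi> (t \<odot> gvar Ggamma) = p' - \<Phi> (gvar Gc \<odot> gvar Ggamma)"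
    using \<alpha>\<gamma> by (simp add: t_eq lin gvar_odd_square)
  ultimately have p': "p' = 0" by simp
  have t_c: "t = - gvar Gc" using t_eq p' q' by simp
  \<comment> \<open>With t = -c, the element s Y - X t equals p Y\<alpha> + q Y\<gamma> - (Y b - X
    c), whose evident primitive is \<open>r0\<close>.\<close>
  define r0 where "r0 = smul p (gvar SYalpha) + smul q (gvar SYgamma) - gvar Gf"
  have comm: "gvar g \<odot> gvar GX = gvar GX \<odot> gvar g" "gvar g \<odot> gvar GY = gvar GY \<odot> gvar g"
    if "g \<in> S" for g
    using that by (auto intro!: gvar_even_commute gvar_in_free_gr)
  have "r0 \<in> free_gr S 4"
    unfolding r0_def by (intro free_gr_add free_gr_diff free_gr_smul gvar_in_free_gr) auto
  then have "r - r0 \<in> free_gr S 4"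
    using r(1) by (rule free_gr_diff[rotated])
  moreover have "D (r - r0) = 0"
    by (simp add: deriv_ext_linear r(2) r0_def s_eq t_c gmul_distribs comm)
  ultimately obtain c1 c2 c3 where c: "r - r0 = smul c1 (gvar GX \<odot> gvar GX) +
      smul c2 (gvar GX \<odot> gvar GY) + smul c3 (gvar GY \<odot> gvar GY)"
    by (rule cocycle_degree_4)
  \<comment> \<open>X times a quadratic monomial in X and Y is the boundary of X a, X b or X c.
    Hence the quadratic ambiguity of r is invisible to \<Phi>(X r).\<close>
  have "\<Phi> (gvar GX \<odot> \<delta> g) = 0" if "g \<in> S" "gdeg g = 3" for g
    using d\<Phi>[of "gvar GX \<odot> gvar g"] that
    by (simp add: D_gvar_gmul[OF _ gvar_in_free_gr] gmul_gvar_in_free_gr sgn_int_def)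
  from this[of Ga] this[of Gb] this[of Gc] have "\<Phi> (gvar GX \<odot> (r - r0)) = 0"
    by (simp add: c lin)
  then have "\<Phi> (gvar GX \<odot> r) = p * \<Phi> (gvar GX \<odot> gvar SYalpha) + q * \<Phi> (gvar GX \<odot> gvar SYgamma)
      - \<Phi> (gvar GX \<odot> gvar Gf)"
    using free_gr_imp_free_gca[OF r(1)] by (simp add: lin r0_def)
  moreover have "r \<odot> gvar GX = gvar GX \<odot> r"
    using r(1) by (intro gvar_even_commute) auto
  moreover have "\<theta> (gvar GX \<odot> gvar GX) = \<sigma> * \<psi> (gvar GY \<odot> gvar Ga) - \<Phi> (gvar Ga \<odot> gvar Gc)"
  proof -
    have "- \<sigma> * \<theta> (gvar GX \<odot> gvar GX) = - \<psi> (gvar GY \<odot> gvar Ga) + \<sigma> * \<Phi> (gvar Ga \<odot> gvar Gc)"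
      using d\<theta>[of Ga] by (simp add: t_c lin gvar_odd_anticommute[of Gc Ga])
    then have "\<sigma> * (\<sigma> * \<theta> (gvar GX \<odot> gvar GX)) = \<sigma> * (\<psi> (gvar GY \<odot> gvar Ga) - \<sigma> * \<Phi> (gvar Ga \<odot> gvar Gc))"
      by simp
    then show ?thesis by (simp add: sq right_diff_distrib)
  qed
  moreover have "\<sigma> * \<psi> (s \<odot> gvar GX) =
      - p * \<Phi> (gvar GY \<odot> gvar SXalpha) - q * \<Phi> (gvar GY \<odot> gvar SXgamma) - \<sigma> * \<psi> (gvar GX \<odot> gvar Gb)"
  proof -
    have "\<sigma> * \<psi> (s \<odot> gvar GX) = p * (\<sigma> * \<psi> (gvar GX \<odot> gvar Galpha)) +
        q * (\<sigma> * \<psi> (gvar GX \<odot> gvar Ggamma)) - \<sigma> * \<psi> (gvar GX \<odot> gvar Gb)"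
      by (simp add: s_eq lin comm algebra_simps)
    then show ?thesis by (simp add: \<psi>s)
  qed
  \<comment> \<open>This is the equation for \<psi> at e, as D e = Y a - X b.\<close>
  moreover have "\<sigma> * \<psi> (gvar GY \<odot> gvar Ga) - \<sigma> * \<psi> (gvar GX \<odot> gvar Gb) = - \<Phi> (gvar GY \<odot> gvar Ge)"
    using \<psi>e by (simp add: lin right_diff_distrib)
  \<comment> \<open>The p and q terms cancel by 2 and 3, leaving \<Phi>(Ye) + \<Phi>(ac) +
    \<Phi>(Xf).\<close>
  ultimately show ?thesis
    using 1 by (simp add: 2 3)
qed

text \<open>\<open>xd\<close>, \<open>yd\<close>, \<open>yd'\<close>, \<open>\<Phi>\<close> are the
  dual parts of \<open>a 0 1\<close>, \<open>a 1 2\<close>, \<open>a 2 3\<close>,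
  \<open>a 3 4\<close>, and \<open>sd\<close>, \<open>td\<close>, \<open>rd\<close>,
  \<open>\<psi>\<close>, \<open>\<theta>\<close> those of \<open>a 0 2\<close>,
  \<open>a 1 3\<close>, \<open>a 0 3\<close>, \<open>a 2 4\<close>, \<open>a 1 4\<close>; s, t, r
  are the parts of \<open>a 0 2\<close>, \<open>a 1 3\<close>, \<open>a 0 3\<close> in B. The parts
  of \<open>a 3 4\<close>, \<open>a 2 4\<close>, \<open>a 1 4\<close> in B are written through u, w,
  z, so that the extra terms can be integrated by parts.\<close>

lemma value_at_X:
  fixes \<Phi> \<psi> \<theta> xd yd yd' sd td rd :: "gen elt \<Rightarrow> rat" and n :: nat
  defines "\<sigma> \<equiv> sgn_int (int n)"
  assumes xd: "xd \<in> dual_gr n S 2" "\<And>v k. v \<in> free_gr S k \<Longrightarrow> xd (D v) = 0"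
    and yd: "yd \<in> dual_gr n S 2" "\<And>v k. v \<in> free_gr S k \<Longrightarrow> yd (D v) = 0"
    and yd': "yd' \<in> dual_gr n S 2" "\<And>v k. v \<in> free_gr S k \<Longrightarrow> yd' (D v) = 0"
    and \<Phi>: "\<Phi> \<in> dual_gr n S (int n - 6)" "\<And>v k. v \<in> free_gr S k \<Longrightarrow> \<Phi> (D v) = 0"
    and sd: "sd \<in> dual_gr n S 3"
      "\<And>v k. v \<in> free_gr S k \<Longrightarrow> sd (D v) = - (yd (gvar GX \<odot> v) + xd (gvar GY \<odot> v))"
    and td: "td \<in> dual_gr n S 3"
      "\<And>v k. v \<in> free_gr S k \<Longrightarrow> td (D v) = - (yd' (gvar GY \<odot> v) + yd (gvar GY \<odot> v))"
    and rd: "rd \<in> dual_gr n S 4"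
      "\<And>v k. v \<in> free_gr S k \<Longrightarrow>
        - rd (D v) = - (td (gvar GX \<odot> v) + xd (t \<odot> v)) + (yd' (s \<odot> v) + sd (gvar GY \<odot> v))"
    and \<psi>: "\<psi> \<in> dual_gr n S (int n - 5)"
      "\<And>v. v \<in> free_gr S 4 \<Longrightarrow> \<sigma> * \<psi> (D v) = - (\<Phi> (gvar GY \<odot> v) + yd' (D u \<odot> v))"
    and \<theta>: "\<theta> \<in> dual_gr n S (int n - 4)"
      "\<And>v. v \<in> free_gr S 3 \<Longrightarrow> - \<sigma> * \<theta> (D v) =
        - (\<psi> (gvar GY \<odot> v) + yd ((D w - gvar GY \<odot> u) \<odot> v)) + (\<sigma> * \<Phi> (t \<odot> v) + td (D u \<odot> v))"
    and s: "s \<in> free_gr S 3" "D s = - (gvar GX \<odot> gvar GY)"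
    and t: "t \<in> free_gr S 3" "D t = - (gvar GY \<odot> gvar GY)"
    and r: "r \<in> free_gr S 4" "D r = s \<odot> gvar GY - gvar GX \<odot> t"
    and u: "u \<in> free_gr S (int n - 7)" and w: "w \<in> free_gr S (int n - 6)"
    and z: "z \<in> free_gr S (int n - 5)"
    and \<alpha>\<gamma>: "\<Phi> (gvar Galpha \<odot> gvar Ggamma) = 1"
  shows "- (\<theta> (gvar GX \<odot> gvar GX) + xd ((D z - gvar GY \<odot> w - t \<odot> u) \<odot> gvar GX))
    + (- \<sigma> * \<psi> (s \<odot> gvar GX) + sd ((D w - gvar GY \<odot> u) \<odot> gvar GX))
    - (\<Phi> (r \<odot> gvar GX) + rd (D u \<odot> gvar GX)) = 1"
proof -
  have mem: "u \<in> free_gca S" "w \<in> free_gca S" "z \<in> free_gca S" "D u \<in> free_gca S" "D w \<in> free_gca S"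
    "D z \<in> free_gca S" "s \<in> free_gca S" "t \<in> free_gca S" "r \<in> free_gca S"
    and \<delta>_mem: "\<And>g. g \<in> S \<Longrightarrow> \<delta> g \<in> free_gca S"
    using s t r u w z by (blast intro: free_gr_imp_free_gca D_in_free_gr \<delta>_degree)+
  note lin = dual_linear[OF xd(1)] dual_linear[OF yd(1)] dual_linear[OF yd'(1)] dual_linear[OF \<Phi>(1)]
    dual_linear[OF sd(1)] dual_linear[OF td(1)] dual_linear[OF rd(1)] dual_linear[OF \<psi>(1)]
    dual_linear[OF \<theta>(1)] gmul_distribs free_gca_closed mem \<delta>_mem
  have sgn: "sgn_int (int n - 7) = - \<sigma>" "sgn_int (int n - 6) = \<sigma>" "sgn_int (int n - 5) = - \<sigma>"
    by (simp_all add: \<sigma>_def sgn_int_def)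
  have uY: "u \<odot> (gvar GY \<odot> v) = gvar GY \<odot> (u \<odot> v)" and uX: "u \<odot> (gvar GX \<odot> v) = gvar GX \<odot> (u \<odot> v)"
    and wX: "w \<odot> (gvar GX \<odot> v) = gvar GX \<odot> (w \<odot> v)" for v
    using gvar_even_commute[OF _ _ u, of GX] gvar_even_commute[OF _ _ u, of GY]
      gvar_even_commute[OF _ _ w, of GX] by (simp_all flip: gmul_assoc)
  have us: "u \<odot> (s \<odot> v) = smul (- \<sigma>) (s \<odot> (u \<odot> v))" for v
    using gmul_left_commute[OF u s(1)] by (simp add: \<sigma>_def sgn_int_def)
  \<comment> \<open>Since \<open>yd'\<close> kills D (u g), the term \<open>yd'\<close> (D u g)
    equals \<sigma> times \<open>yd'\<close> (u (D g)), and can be absorbed into \<psi>. The same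
    device with \<open>yd\<close> and w, and with \<open>td\<close> and u, produces
    \<open>\<theta>'\<close>; the new functionals satisfy the equations without u, w, z.\<close>
  define \<psi>' where "\<psi>' = \<psi> + right_act S yd' u"
  define \<theta>' where "\<theta>' = \<theta> + right_act S yd w + right_act S td u"
  have \<psi>'_apply: "\<psi>' v = \<psi> v + yd' (u \<odot> v)"
    and \<theta>'_apply: "\<theta>' v = \<theta> v + yd (w \<odot> v) + td (u \<odot> v)" if "v \<in> free_gca S" for v
    using that by (simp_all add: \<psi>'_def \<theta>'_def right_act_apply)
  have sq: "\<sigma> * (\<sigma> * c) = c" for c
    by (simp add: \<sigma>_def)
  have Du: "D (u \<odot> gvar g) = D u \<odot> gvar g - smul \<sigma> (u \<odot> \<delta> g)"
    and Dw: "D (w \<odot> gvar g) = D w \<odot> gvar g + smul \<sigma> (w \<odot> \<delta> g)"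
    and Dz: "D (z \<odot> gvar g) = D z \<odot> gvar g - smul \<sigma> (z \<odot> \<delta> g)"
    and ug: "u \<odot> gvar g \<in> free_gr S (int n - 7 + int (gdeg g))"
    and wg: "w \<odot> gvar g \<in> free_gr S (int n - 6 + int (gdeg g))"
    and zg: "z \<odot> gvar g \<in> free_gr S (int n - 5 + int (gdeg g))" if "g \<in> S" for g
    using that D_gmul_gvar[OF that u] D_gmul_gvar[OF that w] D_gmul_gvar[OF that z] u w z
    by (auto simp: sgn smul_minus_left intro!: gmul_in_free_gr gvar_in_free_gr)
  have "- \<theta>' (gvar GX \<odot> gvar GX) - \<sigma> * \<psi>' (s \<odot> gvar GX) - \<Phi> (r \<odot> gvar GX) = 1"
  proof (rule value_at_X_reduced[OF _ \<Phi>(1) _ _ s t r])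
    show "\<sigma> * \<sigma> = 1" by (simp add: \<sigma>_def)
    show "\<psi>' \<in> dual_gr n S (int n - 5)"
      unfolding \<psi>'_def by (intro dual_gr_add right_act_in_dual_gr[OF yd'(1) u] \<psi>(1)) simp
    show "\<theta>' \<in> dual_gr n S (int n - 4)"
      unfolding \<theta>'_def
      by (intro dual_gr_add right_act_in_dual_gr[OF yd(1) w] right_act_in_dual_gr[OF td(1) u] \<theta>(1)) simp_all
    show "\<Phi> (D v) = 0" if "v \<in> free_gr S 5" for v
      using \<Phi>(2) that .
    show "\<Phi> (gvar Galpha \<odot> gvar Ggamma) = 1" by (rule \<alpha>\<gamma>)
    fix g assume g: "g \<in> S"
    show "\<sigma> * \<psi>' (\<delta> g) = - \<Phi> (gvar GY \<odot> gvar g)" if "gdeg g = 4"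
    proof -
      have "gvar g \<in> free_gr S 4" using g that by (auto intro: gvar_in_free_gr)
      from \<psi>(2)[OF this] yd'(2)[OF ug[OF g]] show ?thesis
        using g by (simp add: \<psi>'_apply lin sq Du algebra_simps)
    qed
    show "- \<sigma> * \<theta>' (\<delta> g) = - \<psi>' (gvar GY \<odot> gvar g) + \<sigma> * \<Phi> (t \<odot> gvar g)" if "gdeg g = 3"
    proof -
      have "gvar g \<in> free_gr S 3" using g that by (auto intro: gvar_in_free_gr)
      from \<theta>(2)[OF this] yd(2)[OF wg[OF g]] td(2)[OF ug[OF g]] show ?thesis
        using g by (simp add: \<psi>'_apply \<theta>'_apply lin sq Du Dw uY gmul_assoc algebra_simps)
    qed
  qed
  \<comment> \<open>X is closed, so D (z X) = D z X, and likewise for w and u. After this rewriting,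
    the extra terms of the value cancel against the differences of \<open>\<psi>'\<close> and
    \<open>\<theta>'\<close> from \<psi> and \<theta>.\<close>
  moreover have "xd (D z \<odot> gvar GX) = 0"
    using xd(2)[OF zg[of GX]] by (simp add: Dz)
  moreover have "sd (D w \<odot> gvar GX) =
      - (yd (gvar GX \<odot> (w \<odot> gvar GX)) + xd (gvar GY \<odot> (w \<odot> gvar GX)))"
    using sd(2)[OF wg[of GX]] by (simp add: Dw)
  moreover have "- rd (D u \<odot> gvar GX) =
      - (td (gvar GX \<odot> (u \<odot> gvar GX)) + xd (t \<odot> (u \<odot> gvar GX)))
      + (yd' (s \<odot> (u \<odot> gvar GX)) + sd (gvar GY \<odot> (u \<odot> gvar GX)))"
    using rd(2)[OF ug[of GX]] by (simp add: Du)
  ultimately show ?thesis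
    by (simp add: \<psi>'_apply \<theta>'_apply lin sq uX wX us gmul_assoc algebra_simps)
qed

section \<open>Every value in the dualization is nonzero\<close>

lemma PB_simps [simp]:
  "gr (PB n I zV J zW) k = free_gr S k \<times> dual_gr n S k"
  "mul (PB n I zV J zW) x y =
    (fst x \<odot> fst y, left_act n S (fst x) (snd y) + right_act S (snd x) (fst y))"
  "diff (PB n I zV J zW) x = (D (fst x), dual_diff n S \<delta> (snd x))"
  by (simp_all add: PB_def poincare_dualization_def case_prod_beta)

lemma coh_class_PB_self: "x \<in> coh_class (PB n I zV J zW) k x"
  by (auto simp: coh_class_def zero_prod_def intro!: exI[of _ 0])

lemma free_gr_degree_1: "f \<in> free_gr S 1 \<Longrightarrow> f = 0"
proof -
  assume f: "f \<in> free_gr S 1"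
  have "p \<notin> Poly_Mapping.keys f" for p
    using f mdeg_ge[of p] by (cases "size p") (auto simp: free_gr_alt)
  then show "f = 0" by (metis all_not_in_conv keys_eq_empty)
qed

text \<open>B vanishes in degree 1, so representatives of these degree 2 classes vary in their dual
  part only.\<close>

lemma coh_class_PB_gvar:
  assumes "x \<in> coh_class (PB n I zV J zW) 2 (gvar g, 0)"
  shows "fst x = gvar g"
  using assms by (auto simp: coh_class_def dest!: free_gr_degree_1)

lemma zero_notin_massey_product:
  fixes n :: nat
  assumes "n \<ge> 12"
  defines "P \<equiv> PB n I zV J zW"
  defines "xs \<equiv> [(2, coh_class P 2 (gvar GX, 0)), (2, coh_class P 2 (gvar GY, 0)),
     (2, coh_class P 2 (gvar GY, 0)),
     (int n - 6, coh_class P (int n - 6) (0, hat S {#GY, Ge#} + hat S {#Galpha, Ggamma#}))]"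
  shows "coh_class P (massey_deg xs 0 (length xs) + 1) 0 \<notin> massey_product P xs"
proof
  \<comment> \<open>Keeps the index \<open>1\<close> from being rewritten to \<open>Suc 0\<close>,
    so that the entries of the system match.\<close>
  note One_nat_def [simp del]
  assume "coh_class P (massey_deg xs 0 (length xs) + 1) 0 \<in> massey_product P xs"
  then obtain a where a: "defining_system P xs a"
    and trivial: "coh_class P (massey_deg xs 0 (length xs) + 1) (massey_value P xs a) =
      coh_class P (massey_deg xs 0 (length xs) + 1) 0"
    by (auto simp: massey_product_def)
  define p where "p i j = fst (a i j)" for i j
  define q where "q i j = snd (a i j)" for i j
  have a_eq: "a i j = (p i j, q i j)" for i j by (simp add: p_def q_def)
  note sys = a[unfolded xs_def defining_system_4]
  have X: "p 0 1 = gvar GX" and Y: "p 1 2 = gvar GY" and Y': "p 2 3 = gvar GY"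
    using sys coh_class_PB_gvar unfolding p_def P_def by blast+
  have p: "p 0 2 \<in> free_gr S 3" "p 1 3 \<in> free_gr S 3" "p 2 4 \<in> free_gr S (int n - 5)"
      "p 0 3 \<in> free_gr S 4" "p 1 4 \<in> free_gr S (int n - 4)"
    and q: "q 0 1 \<in> dual_gr n S 2" "q 1 2 \<in> dual_gr n S 2" "q 2 3 \<in> dual_gr n S 2"
      "q 3 4 \<in> dual_gr n S (int n - 6)" "q 0 2 \<in> dual_gr n S 3" "q 1 3 \<in> dual_gr n S 3"
      "q 2 4 \<in> dual_gr n S (int n - 5)" "q 0 3 \<in> dual_gr n S 4" "q 1 4 \<in> dual_gr n S (int n - 4)"
    using sys by (simp_all add: P_def a_eq)
  have dp: "D (p 0 2) = - (gvar GX \<odot> gvar GY)" "D (p 1 3) = - (gvar GY \<odot> gvar GY)"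
      "D (p 2 4) = - (gvar GY \<odot> p 3 4)"
      "D (p 0 3) = - (gvar GX \<odot> p 1 3) + p 0 2 \<odot> gvar GY"
      "D (p 1 4) = - (gvar GY \<odot> p 2 4) + p 1 3 \<odot> p 3 4"
    and closed: "dual_diff n S \<delta> (q 0 1) = 0" "dual_diff n S \<delta> (q 1 2) = 0"
      "dual_diff n S \<delta> (q 2 3) = 0" "dual_diff n S \<delta> (q 3 4) = 0"
    and dq: "dual_diff n S \<delta> (q 0 2) = left_act n S (- gvar GX) (q 1 2) + right_act S (- q 0 1) (gvar GY)"
      "dual_diff n S \<delta> (q 1 3) = left_act n S (- gvar GY) (q 2 3) + right_act S (- q 1 2) (gvar GY)"
      "dual_diff n S \<delta> (q 2 4) = left_act n S (- gvar GY) (q 3 4) + right_act S (- q 2 3) (p 3 4)"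
      "dual_diff n S \<delta> (q 0 3) = left_act n S (- gvar GX) (q 1 3) + right_act S (- q 0 1) (p 1 3)
        + (left_act n S (p 0 2) (q 2 3) + right_act S (q 0 2) (gvar GY))"
      "dual_diff n S \<delta> (q 1 4) = left_act n S (- gvar GY) (q 2 4) + right_act S (- q 1 2) (p 2 4)
        + (left_act n S (p 1 3) (q 3 4) + right_act S (q 1 3) (p 3 4))"
    using sys by (simp_all add: P_def a_eq bar_def X Y Y' zero_prod_def)
  have "a 3 4 \<in> coh_class P (int n - 6) (0, hat S {#GY, Ge#} + hat S {#Galpha, Ggamma#})"
    using sys by blast
  then obtain u \<chi> where u: "u \<in> free_gr S (int n - 7)" and Du: "p 3 4 = D u"
    and \<chi>: "\<chi> \<in> dual_gr n S (int n - 7)"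
    and q34: "q 3 4 = hat S {#GY, Ge#} + hat S {#Galpha, Ggamma#} + dual_diff n S \<delta> \<chi>"
    by (auto simp: coh_class_def P_def a_eq)
  have gX: "gvar GX \<in> free_gr S 2" and gY: "gvar GY \<in> free_gr S 2"
    by (auto intro: gvar_in_free_gr)
  have DY: "D (gvar GY \<odot> f) = gvar GY \<odot> D f" if "f \<in> free_gr S k" for f k
    using D_gvar_gmul[OF _ that, of GY] by (simp add: sgn_int_def)
  \<comment> \<open>D (p 2 4) = - Y D u = - D (Y u), so adding Y u gives a cocycle of degree n - 5,
    which is at least 7.\<close>
  have "D (p 2 4 + gvar GY \<odot> u) = 0"
    by (simp add: deriv_ext_add dp(3) DY[OF u] Du)
  moreover have "p 2 4 + gvar GY \<odot> u \<in> free_gr S (int n - 5)"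
    by (intro free_gr_add p gmul_in_free_gr[OF gY u]) simp
  ultimately obtain w where w: "w \<in> free_gr S (int n - 6)" "D w = p 2 4 + gvar GY \<odot> u"
    using exact_ge_7[of "p 2 4 + gvar GY \<odot> u" "int n - 5"] \<open>n \<ge> 12\<close> by auto
  have p24: "p 2 4 = D w - gvar GY \<odot> u" using w(2) by simp
  \<comment> \<open>The Leibniz rule is available with a generator as one factor;
    \<open>p 1 3\<close> is first expanded into c, \<alpha> and \<gamma>.\<close>
  have D13u: "D (p 1 3 \<odot> u) = - (gvar GY \<odot> (gvar GY \<odot> u)) - p 1 3 \<odot> D u"
    using p(2) dp(2)
  proof (cases rule: primitive_YY)
    case (1 b c)
    have "D (gvar g \<odot> u) = \<delta> g \<odot> u - gvar g \<odot> D u" if "g \<in> {Gc, Galpha, Ggamma}" for g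
      using D_gvar_gmul[OF _ u, of g] that by (auto simp: sgn_int_def smul_minus_one)
    then show ?thesis
      by (simp add: 1 gmul_distribs deriv_ext_linear smul_diff smul_minus gmul_assoc)
  qed
  \<comment> \<open>The correction Y w + \<open>p 1 3\<close> u is chosen so that its boundary
    cancels D (p 1 4) once \<open>p 2 4\<close> and \<open>p 3 4\<close> are expressed by w and
    u.\<close>
  let ?z = "p 1 4 + gvar GY \<odot> w + p 1 3 \<odot> u"
  have "D ?z = 0"
    by (simp add: deriv_ext_add dp(5) DY[OF w(1)] D13u Du w(2) gmul_distribs)
  moreover have "?z \<in> free_gr S (int n - 4)"
    by (intro free_gr_add p gmul_in_free_gr[OF gY w(1)] gmul_in_free_gr[OF p(2) u]) simp_all
  ultimately obtain z where z: "z \<in> free_gr S (int n - 5)" "D z = ?z"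
    using exact_ge_7[of ?z "int n - 4"] \<open>n \<ge> 12\<close> by auto
  have p14: "p 1 4 = D z - gvar GY \<odot> w - p 1 3 \<odot> u" using z(2) by simp
  note gca = free_gr_imp_free_gca
  have D_gca: "D v \<in> free_gca S" if "v \<in> free_gr S k" for v k
    using D_in_free_gca gca that by blast
  have mem: "p 0 2 \<in> free_gca S" "p 1 3 \<in> free_gca S" "p 0 3 \<in> free_gca S" "p 3 4 \<in> free_gca S"
      "p 2 4 \<in> free_gca S" "p 1 4 \<in> free_gca S"
    using p gca D_gca[OF u] Du by auto
  note gX' = free_gr_uminus[OF gX] and gY' = free_gr_uminus[OF gY]
  note simps = left_act_apply[OF q(2) gX'] left_act_apply[OF q(3) gY'] left_act_apply[OF q(4) gY']
    left_act_apply[OF q(6) gX'] left_act_apply[OF q(3) p(1)] left_act_apply[OF q(7) gY']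
    left_act_apply[OF q(4) p(2)] left_act_apply[OF q(9) gX'] left_act_apply[OF q(7) p(1)]
    left_act_apply[OF q(4) free_gr_uminus[OF p(4)]]
    right_act_apply dual_diff_apply[OF q(1)] dual_diff_apply[OF q(2)] dual_diff_apply[OF q(3)]
    dual_diff_apply[OF q(4)] dual_diff_apply[OF q(5)] dual_diff_apply[OF q(6)]
    dual_diff_apply[OF q(7)] dual_diff_apply[OF q(8)] dual_diff_apply[OF q(9)]
    q[THEN dual_minus] free_gca_gmul mem
  have sgns: "sgn_int 0 = 1" "sgn_int 1 = - 1" "sgn_int 2 = 1" "sgn_int 3 = - 1" "sgn_int 4 = 1" "sgn_int 6 = 1"
    "sgn_int (2 * int n - 8) = 1" "sgn_int (2 * int n - 10) = 1" "sgn_int (2 * int n - 12) = 1"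
    "sgn_int (4 * int n - 24) = 1" "sgn_int (int n - 6) = sgn_int (int n)" "sgn_int (int n - 7) = - sgn_int (int n)"
    "sgn_int (int n - 5) = - sgn_int (int n)" "sgn_int (3 * int n - 18) = sgn_int (int n)"
    "sgn_int (3 * int n - 15) = - sgn_int (int n)"
    by (simp_all add: sgn_int_def)
  have "- (q 1 4 (gvar GX \<odot> gvar GX) + q 0 1 ((D z - gvar GY \<odot> w - p 1 3 \<odot> u) \<odot> gvar GX))
    + (- sgn_int (int n) * q 2 4 (p 0 2 \<odot> gvar GX) + q 0 2 ((D w - gvar GY \<odot> u) \<odot> gvar GX))
    - (q 3 4 (p 0 3 \<odot> gvar GX) + q 0 3 (D u \<odot> gvar GX)) = 1"
  proof (rule value_at_X[OF q(1) _ q(2) _ q(3) _ q(4) _ q(5) _ q(6) _ q(8) _ q(7) _ q(9) _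
        p(1) dp(1) p(2) dp(2) p(4) _ u w(1) z(1)])
    fix v k assume v: "v \<in> free_gr S k"
    note v' = gca[OF v] D_gca[OF v]
    show "q 0 1 (D v) = 0" "q 1 2 (D v) = 0" "q 2 3 (D v) = 0" "q 3 4 (D v) = 0"
      using closed[THEN fun_cong, of v] by (simp_all add: simps v' sgns)
    show "q 0 2 (D v) = - (q 1 2 (gvar GX \<odot> v) + q 0 1 (gvar GY \<odot> v))"
      using dq(1)[THEN fun_cong, of v] by (simp add: simps v' sgns)
    show "q 1 3 (D v) = - (q 2 3 (gvar GY \<odot> v) + q 1 2 (gvar GY \<odot> v))"
      using dq(2)[THEN fun_cong, of v] by (simp add: simps v' sgns)
    show "- q 0 3 (D v) = - (q 1 3 (gvar GX \<odot> v) + q 0 1 (p 1 3 \<odot> v))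
        + (q 2 3 (p 0 2 \<odot> v) + q 0 2 (gvar GY \<odot> v))"
      using dq(4)[THEN fun_cong, of v] by (simp add: simps v' sgns)
  next
    fix v assume v: "v \<in> free_gr S 4"
    note v' = gca[OF v] D_gca[OF v]
    show "sgn_int (int n) * q 2 4 (D v) = - (q 3 4 (gvar GY \<odot> v) + q 2 3 (D u \<odot> v))"
      using dq(3)[THEN fun_cong, of v] by (simp add: simps v' sgns flip: Du)
  next
    fix v assume v: "v \<in> free_gr S 3"
    note v' = gca[OF v] D_gca[OF v]
    show "- sgn_int (int n) * q 1 4 (D v) =
        - (q 2 4 (gvar GY \<odot> v) + q 1 2 ((D w - gvar GY \<odot> u) \<odot> v))
        + (sgn_int (int n) * q 3 4 (p 1 3 \<odot> v) + q 1 3 (D u \<odot> v))"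
      using dq(5)[THEN fun_cong, of v] by (simp add: simps v' sgns flip: Du p24)
  next
    show "D (p 0 3) = p 0 2 \<odot> gvar GY - gvar GX \<odot> p 1 3"
      by (simp add: dp(4))
    \<comment> \<open>The representative may differ from the given functional by the coboundary of
      \<chi>, which vanishes on the closed element \<alpha>\<gamma>.\<close>
    have "D (gvar Galpha \<odot> gvar Ggamma) = 0"
      by (simp add: D_gvar_gmul[OF _ gvar_in_free_gr])
    moreover have "{#GY, Ge#} \<noteq> {#Galpha, Ggamma#}" by (simp add: pair_mset_eq)
    moreover have "gvar Galpha \<odot> gvar Ggamma \<in> free_gca S"
      by (simp add: free_gca_gmul)
    ultimately show "q 3 4 (gvar Galpha \<odot> gvar Ggamma) = 1"
      by (simp add: q34 dual_diff_apply[OF \<chi>] dual_zero[OF \<chi>])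
        (simp add: hat_def basis_monomial_alpha_gamma lookup_single)
  qed
  then have "snd (massey_value P xs a) (gvar GX) = 1"
    by (simp add: xs_def massey_value_4 P_def a_eq bar_def X simps sgns flip: p14 p24 Du)
  moreover have "massey_value P xs a \<in> coh_class P (massey_deg xs 0 (length xs) + 1) 0"
    unfolding trivial[symmetric] by (simp add: P_def coh_class_PB_self)
  then obtain b \<eta> where "massey_value P xs a = diff P (b, \<eta>)"
    "\<eta> \<in> dual_gr n S (massey_deg xs 0 (length xs) + 1 - 1)"
    by (auto simp: coh_class_def P_def zero_prod_def)
  \<comment> \<open>The dual part of a coboundary at X is, up to sign, \<eta> (D X) = \<eta>
    0.\<close>
  then have "snd (massey_value P xs a) (gvar GX) = 0"
    by (simp add: P_def dual_diff_apply dual_zero)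
  ultimately show False by simp
qed

section \<open>Existence of a defining system\<close>

lemma monomials_degree_5:
  assumes "p \<in> monomials S" "mdeg p = 5"
  shows "p \<in> {{#Gh#}, {#Gi#}, {#T1#}, {#T2#}, {#T3#}, {#T4#}, {#T5#}, {#T6#}, {#T7#}, {#T8#}, {#T9#}} \<or>
    (\<exists>g\<in>{GX, GY}. \<exists>h\<in>{Ga, Gb, Gc, Galpha, Ggamma}. p = {#g, h#})"
proof -
  have "mdeg p < 6" using assms(2) by simp
  with assms(1) show ?thesis
  proof (cases rule: low_degree_cases)
    case (gen g)
    then show ?thesis using assms(2) gdeg_5[of g] by auto
  next
    case (prod g h)
    then show ?thesis using assms(2) gdeg_2[of g] gdeg_3[of h] by auto
  qed (use assms(2) in auto)
qed

lemma D_single_gen: "D (Poly_Mapping.single {#g#} c) = smul c (\<delta> g)"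
  using deriv_ext_smul[of \<delta> c "gvar g"] by (simp add: gvar_def deriv_ext_gvar[unfolded gvar_def])

lemma lookup_D_other_degree:
  assumes "p \<in> monomials S" "mdeg r \<noteq> mdeg p + 1"
  shows "Poly_Mapping.lookup (D (Poly_Mapping.single p c)) r = 0"
  using D_single_in_free_gr[OF assms(1), of c] assms(2) by (auto simp: free_gr_alt in_keys_iff)

lemma D_quadratic_single [simp]:
  "D (Poly_Mapping.single {#GX, GX#} c) = 0" "D (Poly_Mapping.single {#GX, GY#} c) = 0"
  "D (Poly_Mapping.single {#GY, GY#} c) = 0"
proof -
  have "Poly_Mapping.single {#GX, GX#} c = smul c (gvar GX \<odot> gvar GX)"
    "Poly_Mapping.single {#GX, GY#} c = smul c (gvar GX \<odot> gvar GY)"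
    "Poly_Mapping.single {#GY, GY#} c = smul c (gvar GY \<odot> gvar GY)"
    by (simp_all add: gvar_def add_mset_commute)
  then show "D (Poly_Mapping.single {#GX, GX#} c) = 0" "D (Poly_Mapping.single {#GX, GY#} c) = 0"
    "D (Poly_Mapping.single {#GY, GY#} c) = 0"
    by (simp_all only: deriv_ext_smul D_quadratic smul_zero)
qed

text \<open>This coefficient determines the coboundary of the functional dual to X^2, and the next
  lemma does the same for Y a. Each monomial occurs in the boundary of a single basis
  monomial.\<close>

lemma lookup_D_XX:
  assumes p: "p \<in> monomials S"
  shows "Poly_Mapping.lookup (D (Poly_Mapping.single p c)) {#GX, GX#} = (if p = {#Ga#} then c else 0)"
proof (cases "mdeg p = 3")
  case True
  show ?thesis
    using monomials_degree_3[OF p True]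
    by (auto simp: D_single_gen) (simp_all add: gvar_def lookup_single pair_mset_eq)
qed (use lookup_D_other_degree[OF p, of "{#GX, GX#}" c] in auto)

lemma lookup_D_Ya:
  assumes p: "p \<in> monomials S"
  shows "Poly_Mapping.lookup (D (Poly_Mapping.single p c)) {#GY, Ga#} = (if p = {#Ge#} then c else 0)"
proof (cases "mdeg p = 4")
  case True
  show ?thesis
    using monomials_degree_4[OF p True]
    by (auto simp: D_single_gen pair_mset_eq)
      (simp_all add: gvar_def lookup_minus lookup_single pair_mset_eq)
qed (use lookup_D_other_degree[OF p, of "{#GY, Ga#}" c] in auto)

text \<open>Gives closedness of the last entry. In degree 5 only t_1 has Ye or \<alpha>\<gamma> in
  its boundary, with coefficients 1 and -1; products of X or Y with a generator of degree 3 have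
  boundaries cubic in X and Y, or zero.\<close>

lemma lookup_D_Ye_alpha_gamma:
  assumes p: "p \<in> monomials S"
  shows "Poly_Mapping.lookup (D (Poly_Mapping.single p c)) {#GY, Ge#} +
    Poly_Mapping.lookup (D (Poly_Mapping.single p c)) {#Galpha, Ggamma#} = 0"
proof (cases "mdeg p = 5")
  case True
  have "Poly_Mapping.lookup (D (Poly_Mapping.single {#g, h#} c)) {#a, b#} = 0"
    if "g \<in> {GX, GY}" "h \<in> {Ga, Gb, Gc, Galpha, Ggamma}" for g h a b
  proof -
    have "Poly_Mapping.single {#g, h#} c = smul c (gvar g \<odot> gvar h)"
      using that by (auto simp: gvar_def add_mset_commute)
    moreover have "D (gvar g \<odot> gvar h) = gvar g \<odot> \<delta> h"
      using that by (auto simp: D_gvar_gmul[OF _ gvar_in_free_gr] sgn_int_def)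
    ultimately show ?thesis
      using that by (auto simp: deriv_ext_smul) (simp_all add: gvar_def lookup_single triple_mset_neq_pair)
  qed
  moreover have "Poly_Mapping.lookup (\<delta> g) {#GY, Ge#} + Poly_Mapping.lookup (\<delta> g) {#Galpha, Ggamma#} = 0"
    if "g \<in> {Gh, Gi, T1, T2, T3, T4, T5, T6, T7, T8, T9}" for g
    using that
    by (auto simp: gen_m_def basis_monomial_alpha_gamma lookup_add lookup_minus)
      (simp_all add: gvar_def lookup_single pair_mset_eq)
  ultimately show ?thesis
    using monomials_degree_5[OF p True]
    by (auto simp: D_single_gen simp flip: distrib_left simp del: d_gen.simps)
qed (use lookup_D_other_degree[OF p, of "{#GY, Ge#}" c]
    lookup_D_other_degree[OF p, of "{#Galpha, Ggamma#}" c] in auto)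

lemma massey_product_defined:
  fixes n :: nat
  defines "P \<equiv> PB n I zV J zW"
  shows "massey_defined P [(2, coh_class P 2 (gvar GX, 0)), (2, coh_class P 2 (gvar GY, 0)),
     (2, coh_class P 2 (gvar GY, 0)),
     (int n - 6, coh_class P (int n - 6) (0, hat S {#GY, Ge#} + hat S {#Galpha, Ggamma#}))]"
proof -
  note One_nat_def [simp del]
  define \<sigma> where "\<sigma> = sgn_int (int n)"
  define \<Phi> where "\<Phi> = hat S {#GY, Ge#} + hat S {#Galpha, Ggamma#}"
  \<comment> \<open>The equation for \<psi> asks for the value -1 at e. As D e contains Y a and the
    differential of the dual carries the sign \<sigma> in this degree, the coefficient is -
    \<sigma>. Likewise the equation for \<theta> asks for \<sigma> at a, where D a = X^2 and the
    sign is - \<sigma>.\<close>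
  define \<psi> where "\<psi> = (\<lambda>y. - \<sigma> * hat S {#GY, Ga#} y)"
  define \<theta> where "\<theta> = (\<lambda>y. - 1 * hat S {#GX, GX#} y)"
  have \<Phi>: "\<Phi> \<in> dual_gr n S (int n - 6)"
    unfolding \<Phi>_def by (intro dual_gr_add hat_in_dual_gr) simp_all
  have \<psi>: "\<psi> \<in> dual_gr n S (int n - 5)"
    unfolding \<psi>_def by (intro dual_gr_scale hat_in_dual_gr) simp_all
  have \<theta>: "\<theta> \<in> dual_gr n S (int n - 4)"
    unfolding \<theta>_def by (intro dual_gr_scale hat_in_dual_gr) simp_all
  have gY: "- gvar GY \<in> free_gr S 2" and gc: "- gvar Gc \<in> free_gr S 3"
    by (auto intro!: gvar_in_free_gr free_gr_uminus)
  have sq: "\<sigma> * (\<sigma> * c) = c" for c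
    by (simp add: \<sigma>_def)
  have sgns: "sgn_int (int n - 7) = - \<sigma>" "sgn_int (int n - 6) = \<sigma>" "sgn_int (int n - 5) = - \<sigma>"
    "sgn_int (2 * int n - 10) = 1" "sgn_int (2 * int n - 12) = 1" "sgn_int (3 * int n - 18) = \<sigma>"
    by (simp_all add: sgn_int_def \<sigma>_def)
  have hat_D: "hat S r (D (Poly_Mapping.single p c)) = Poly_Mapping.lookup (D (Poly_Mapping.single p c)) r"
    if "p \<in> monomials S" for p c r
    using D_in_free_gca[OF single_in_free_gca[OF that]] by (simp add: hat_def)
  have hat_gvar: "hat S r (gvar g \<odot> Poly_Mapping.single p c) =
      (if add_mset g p = r then c * koszul {#g#} p else 0)" if "p \<in> monomials S" "g \<in> S" for g p c r
    using free_gca_gmul[OF _ single_in_free_gca[OF that(1)], of "gvar g" c] that(2)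
    by (simp add: hat_def) (simp add: gvar_def lookup_single when_def)
  have "dual_diff n S \<delta> \<Phi> = 0"
  proof (rule dual_gr_eqI)
    show "dual_diff n S \<delta> \<Phi> \<in> dual_gr n S (int n - 5)"
      by (intro dual_diff_in_dual_gr[OF \<Phi>]) simp
    show "dual_diff n S \<delta> \<Phi> (Poly_Mapping.single p c) = 0 (Poly_Mapping.single p c)"
      if "p \<in> monomials S" for p c
      using lookup_D_Ye_alpha_gamma[OF that, of c] that
      by (simp add: dual_diff_apply[OF \<Phi>] single_in_free_gca) (simp add: \<Phi>_def hat_D)
  qed simp
  moreover have "dual_diff n S \<delta> \<psi> = left_act n S (- gvar GY) \<Phi>"
  proof (rule dual_gr_eqI)
    show "dual_diff n S \<delta> \<psi> \<in> dual_gr n S (int n - 4)"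
      by (intro dual_diff_in_dual_gr[OF \<psi>]) simp
    show "left_act n S (- gvar GY) \<Phi> \<in> dual_gr n S (int n - 4)"
      by (intro left_act_in_dual_gr[OF \<Phi> gY]) simp
    show "dual_diff n S \<delta> \<psi> (Poly_Mapping.single p c) = left_act n S (- gvar GY) \<Phi> (Poly_Mapping.single p c)"
      if p: "p \<in> monomials S" for p c
    proof -
      have "add_mset GY p = {#GY, Ge#} \<longleftrightarrow> p = {#Ge#}" "add_mset GY p \<noteq> {#Galpha, Ggamma#}"
        by (auto simp: add_eq_conv_diff)
      then show ?thesis
        using p by (simp add: dual_diff_apply[OF \<psi>] left_act_apply[OF \<Phi> gY] single_in_free_gca
            dual_minus[OF \<Phi>] free_gca_gmul sgns)
          (simp add: \<psi>_def \<Phi>_def hat_D hat_gvar lookup_D_Ya sq)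
    qed
  qed
  moreover have "dual_diff n S \<delta> \<theta> = left_act n S (- gvar GY) \<psi> + left_act n S (- gvar Gc) \<Phi>"
  proof (rule dual_gr_eqI)
    show "dual_diff n S \<delta> \<theta> \<in> dual_gr n S (int n - 3)"
      by (intro dual_diff_in_dual_gr[OF \<theta>]) simp
    show "left_act n S (- gvar GY) \<psi> + left_act n S (- gvar Gc) \<Phi> \<in> dual_gr n S (int n - 3)"
      by (intro dual_gr_add left_act_in_dual_gr[OF \<psi> gY] left_act_in_dual_gr[OF \<Phi> gc]) simp_all
    show "dual_diff n S \<delta> \<theta> (Poly_Mapping.single p c) =
        (left_act n S (- gvar GY) \<psi> + left_act n S (- gvar Gc) \<Phi>) (Poly_Mapping.single p c)"
      if p: "p \<in> monomials S" for p c
    proof -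
      \<comment> \<open>No product with c is Ye or \<alpha>\<gamma>, so the term c \<Phi> vanishes
        and only Y \<psi> contributes.\<close>
      have "add_mset GY p = {#GY, Ga#} \<longleftrightarrow> p = {#Ga#}" "add_mset Gc p \<noteq> {#GY, Ge#}"
        "add_mset Gc p \<noteq> {#Galpha, Ggamma#}"
        by (auto simp: add_eq_conv_diff)
      then show ?thesis
        using p by (simp add: dual_diff_apply[OF \<theta>] left_act_apply[OF \<psi> gY] left_act_apply[OF \<Phi> gc]
            single_in_free_gca dual_minus[OF \<Phi>] dual_minus[OF \<psi>] free_gca_gmul sgns)
          (simp add: \<theta>_def \<psi>_def \<Phi>_def hat_D hat_gvar lookup_D_XX)
    qed
  qed
  \<comment> \<open>For \<open>a 0 3\<close> = -f: the defining equation has b Y where D f has Y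
    b.\<close>
  moreover have "gvar Gb \<odot> gvar GY = gvar GY \<odot> gvar Gb"
    by (intro gvar_even_commute[OF _ _ gvar_in_free_gr[OF _ refl]]) simp_all
  \<comment> \<open>The last branch supplies the entry (1, 4).\<close>
  moreover define a :: "nat \<Rightarrow> nat \<Rightarrow> gen elt \<times> (gen elt \<Rightarrow> rat)" where
    "a i j = (if (i, j) = (0, 1) then (gvar GX, 0) else if (i, j) = (1, 2) then (gvar GY, 0)
      else if (i, j) = (2, 3) then (gvar GY, 0) else if (i, j) = (3, 4) then (0, \<Phi>)
      else if (i, j) = (0, 2) then (- gvar Gb, 0) else if (i, j) = (1, 3) then (- gvar Gc, 0)
      else if (i, j) = (2, 4) then (0, \<psi>) else if (i, j) = (0, 3) then (- gvar Gf, 0)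
      else (0, \<theta>))" for i j
  ultimately have "defining_system P [(2, coh_class P 2 (gvar GX, 0)), (2, coh_class P 2 (gvar GY, 0)),
     (2, coh_class P 2 (gvar GY, 0)), (int n - 6, coh_class P (int n - 6) (0, \<Phi>))] a"
    unfolding defining_system_4 P_def
    by (auto simp: coh_class_PB_self bar_def zero_prod_def deriv_ext_minus \<Phi> \<psi> \<theta>
        intro!: gvar_in_free_gr free_gr_uminus)
  then show ?thesis
    unfolding massey_defined_def \<Phi>_def by blast
qed

end

theorem lemma4p16:
  fixes n :: nat
    and I J :: "nat \<Rightarrow> nat set"
    and zV zW :: "nat \<Rightarrow> nat \<Rightarrow> gen elt"
  assumes "B_construction I zV J zW"
    and "n \<ge> 12"
  shows "massey_nontrivial (PB n I zV J zW)
    [(2, coh_class (PB n I zV J zW) 2 (gvar GX, 0)),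
     (2, coh_class (PB n I zV J zW) 2 (gvar GY, 0)),
     (2, coh_class (PB n I zV J zW) 2 (gvar GY, 0)),
     (int n - 6, coh_class (PB n I zV J zW) (int n - 6)
        (0, hat (B_gens I J) {#GY, Ge#} + hat (B_gens I J) {#Galpha, Ggamma#}))]"
proof -
  interpret B_algebra I J zV zW
    by unfold_locales (rule assms(1))
  show ?thesis
    unfolding massey_nontrivial_def using massey_product_defined zero_notin_massey_product[OF assms(2)] by blast
qed

end
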